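(* Let $G$ be a finite-dimensional Lie group with a left-invariant metric $\langle\cdot,\cdot\rangle$, and let $u_0\in\mathfrak{g}$ satisfy $\mathrm{ad}^\star_{u_0}u_0=0$ (a steady solution of the Euler-Arnold equation). Let $A,F$ be the linear operators on $\mathfrak{g}$ defined by $$A(v)=\mathrm{ad}_{u_0}v,\qquad F(v)=\mathrm{ad}^\star_{u_0}v+\mathrm{ad}^\star_vu_0 .$$ Suppose that there is a subspace $\Omega\subset\mathfrak{g}$ mapped to itself by both $A$ and $F$, and an operator $S\colon\Omega\to\Omega$ satisfying the Sylvester equation $SF+AS=I$ on $\Omega$. Then there is a conjugate point along the geodesic $\gamma$ with $\gamma(0)=\mathrm{id}$, $\gamma'(0)=u_0$ if for some $\tau>0$ we have $$\det\left(e^{\tau A}Se^{\tau F}-S\right)=0,$$ where the determinant is that of the operator on $\Omega$.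
   Context: $\mathrm{ad}^\star$ is defined by $\langle\mathrm{ad}^\star_uv,w\rangle=\langle v,\mathrm{ad}_uw\rangle$ for all $u,v,w\in\mathfrak{g}$, with $\mathrm{ad}_uw=[u,w]$. When $\mathrm{ad}^\star_{u_0}u_0=0$ the geodesic with initial velocity $u_0$ at the identity is the one-parameter subgroup $\exp(tu_0)$. There is a conjugate point along $\gamma$ if some nontrivial Jacobi field along $\gamma$ vanishes at $t=0$ and at some $t>0$. *)

theory Defs
  imports "HOL-Analysis.Analysis" "Jordan_Normal_Form.Determinant"
begin

section \<open>Smooth maps and smooth manifolds\<close>

text \<open>\<open>C\<^sup>k\<close> maps on an open subset of a Euclidean space.\<close>

primrec Ck_on :: "nat \<Rightarrow> ('a::euclidean_space \<Rightarrow> 'b::real_normed_vector) \<Rightarrow> 'a set \<Rightarrow> bool" where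
  "Ck_on 0 f U \<longleftrightarrow> continuous_on U f"
| "Ck_on (Suc k) f U \<longleftrightarrow>
     (\<forall>x\<in>U. f differentiable (at x)) \<and> (\<forall>v. Ck_on k (\<lambda>x. frechet_derivative f (at x) v) U)"

definition smooth_on :: "('a::euclidean_space \<Rightarrow> 'b::real_normed_vector) \<Rightarrow> 'a set \<Rightarrow> bool" where
  "smooth_on f U \<longleftrightarrow> (\<forall>k. Ck_on k f U)"

text \<open>A chart is a pair of its domain and the coordinate map; values of the coordinate map outside
  the domain are irrelevant.\<close>

type_synonym ('p, 'e) chart = "'p set \<times> ('p \<Rightarrow> 'e)"

definition image_of :: "('p, 'e) chart \<Rightarrow> 'e set" where
  "image_of c = snd c ` fst c"

definition inv_chart :: "('p, 'e) chart \<Rightarrow> 'e \<Rightarrow> 'p" where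
  "inv_chart c = inv_into (fst c) (snd c)"

definition is_chart :: "('p::topological_space, 'e::euclidean_space) chart \<Rightarrow> bool" where
  "is_chart c \<longleftrightarrow> open (fst c) \<and> open (image_of c) \<and>
     homeomorphism (fst c) (image_of c) (snd c) (inv_chart c)"

text \<open>The atlas is not required to be maximal.\<close>

locale smooth_manifold =
  fixes atlas :: "('p::{t2_space, second_countable_topology}, 'e::euclidean_space) chart set"
  assumes charts: "c \<in> atlas \<Longrightarrow> is_chart c"
    and cover: "(\<Union>c\<in>atlas. fst c) = UNIV"
    and compatible: "c \<in> atlas \<Longrightarrow> d \<in> atlas \<Longrightarrow>
      smooth_on (snd d \<circ> inv_chart c) (snd c ` (fst c \<inter> fst d))"

text \<open>The differential at \<open>p\<close> of a map \<open>f\<close>, in the coordinates of the chart \<open>c\<close> around \<open>p\<close> and of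
  the chart \<open>d\<close> around \<open>f p\<close>.  For \<open>f = id\<close> this is the change of coordinates of tangent vectors.\<close>

definition tangent_map ::
    "('p \<Rightarrow> 'p) \<Rightarrow> ('p, 'e::euclidean_space) chart \<Rightarrow> ('p, 'e) chart \<Rightarrow> 'p \<Rightarrow> 'e \<Rightarrow> 'e" where
  "tangent_map f c d p = frechet_derivative (snd d \<circ> f \<circ> inv_chart c) (at (snd c p))"


section \<open>Riemannian geometry in coordinates\<close>

text \<open>Tensor fields are given by their components in every chart, subject to the transformation
  law: \<open>g c x v w\<close> is the value of the metric at the point with coordinates \<open>x\<close> in \<open>c\<close> on the
  tangent vectors with components \<open>v\<close> and \<open>w\<close> in \<open>c\<close>.\<close>

type_synonym ('p, 'e) metric_field = "('p, 'e) chart \<Rightarrow> 'e \<Rightarrow> 'e \<Rightarrow> 'e \<Rightarrow> real"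

definition riemannian_metric ::
    "('p, 'e::euclidean_space) chart set \<Rightarrow> ('p, 'e) metric_field \<Rightarrow> bool" where
  "riemannian_metric atlas g \<longleftrightarrow>
     (\<forall>c\<in>atlas.
        (\<forall>v w. smooth_on (\<lambda>x. g c x v w) (image_of c)) \<and>
        (\<forall>x\<in>image_of c. bilinear (g c x) \<and> (\<forall>v w. g c x v w = g c x w v) \<and>
           (\<forall>v. v \<noteq> 0 \<longrightarrow> g c x v v > 0)) \<and>
        (\<forall>d\<in>atlas. \<forall>p \<in> fst c \<inter> fst d. \<forall>v w.
           g d (snd d p) (tangent_map id c d p v) (tangent_map id c d p w) = g c (snd c p) v w))"

text \<open>The vector representing the linear functional \<open>l\<close> with respect to the inner product \<open>ip\<close>.\<close>

definition riesz :: "('e \<Rightarrow> 'e \<Rightarrow> real) \<Rightarrow> ('e \<Rightarrow> real) \<Rightarrow> 'e" where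
  "riesz ip l = (THE z. \<forall>w. ip z w = l w)"

text \<open>From here to \<open>curvature\<close>, \<open>G\<close> is the metric in one fixed chart. \<open>christoffel G x v w\<close> is
  the vector with components \<open>\<Gamma>\<^sup>k\<^sub>i\<^sub>j v\<^sup>i w\<^sup>j\<close> for the Levi-Civita connection, the right-hand side below
  being \<open>(\<partial>\<^sub>i G\<^sub>j\<^sub>k + \<partial>\<^sub>j G\<^sub>i\<^sub>k - \<partial>\<^sub>k G\<^sub>i\<^sub>j) v\<^sup>i w\<^sup>j y\<^sup>k / 2\<close>.\<close>

definition christoffel ::
    "('e::euclidean_space \<Rightarrow> 'e \<Rightarrow> 'e \<Rightarrow> real) \<Rightarrow> 'e \<Rightarrow> 'e \<Rightarrow> 'e \<Rightarrow> 'e" where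
  "christoffel G x v w = riesz (G x) (\<lambda>y.
     (frechet_derivative (\<lambda>x. G x w y) (at x) v
      + frechet_derivative (\<lambda>x. G x v y) (at x) w
      - frechet_derivative (\<lambda>x. G x v w) (at x) y) / 2)"

text \<open>Covariant derivative of a vector field \<open>X\<close> along a curve \<open>x\<close>.\<close>

definition cov_deriv ::
    "('e::euclidean_space \<Rightarrow> 'e \<Rightarrow> 'e \<Rightarrow> real) \<Rightarrow> (real \<Rightarrow> 'e) \<Rightarrow> (real \<Rightarrow> 'e) \<Rightarrow> real \<Rightarrow> 'e" where
  "cov_deriv G x X t = vector_derivative X (at t)
     + christoffel G (x t) (vector_derivative x (at t)) (X t)"

text \<open>\<open>R(u,v)w\<close> with the convention \<open>R(X,Y)Z = \<nabla>\<^sub>X \<nabla>\<^sub>Y Z - \<nabla>\<^sub>Y \<nabla>\<^sub>X Z - \<nabla>\<^bsub>[X,Y]\<^esub> Z\<close>.\<close>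

definition curvature ::
    "('e::euclidean_space \<Rightarrow> 'e \<Rightarrow> 'e \<Rightarrow> real) \<Rightarrow> 'e \<Rightarrow> 'e \<Rightarrow> 'e \<Rightarrow> 'e \<Rightarrow> 'e" where
  "curvature G x u v w =
     frechet_derivative (\<lambda>x. christoffel G x v w) (at x) u
     - frechet_derivative (\<lambda>x. christoffel G x u w) (at x) v
     + christoffel G x u (christoffel G x v w)
     - christoffel G x v (christoffel G x u w)"

definition velocity ::
    "(real \<Rightarrow> 'p) \<Rightarrow> ('p, 'e::euclidean_space) chart \<Rightarrow> real \<Rightarrow> 'e" where
  "velocity \<gamma> c t = vector_derivative (snd c \<circ> \<gamma>) (at t)"

definition smooth_curve ::
    "('p::topological_space, 'e::euclidean_space) chart set \<Rightarrow> (real \<Rightarrow> 'p) \<Rightarrow> bool" where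
  "smooth_curve atlas \<gamma> \<longleftrightarrow> continuous_on UNIV \<gamma> \<and>
     (\<forall>c\<in>atlas. smooth_on (snd c \<circ> \<gamma>) (\<gamma> -` fst c))"

definition geodesic ::
    "('p::topological_space, 'e::euclidean_space) chart set \<Rightarrow> ('p, 'e) metric_field \<Rightarrow>
      (real \<Rightarrow> 'p) \<Rightarrow> bool" where
  "geodesic atlas g \<gamma> \<longleftrightarrow> smooth_curve atlas \<gamma> \<and>
     (\<forall>c\<in>atlas. \<forall>t. \<gamma> t \<in> fst c \<longrightarrow> cov_deriv (g c) (snd c \<circ> \<gamma>) (velocity \<gamma> c) t = 0)"

text \<open>\<open>J c t\<close> are the components in \<open>c\<close> of the tangent vector at \<open>\<gamma> t\<close>; they are meaningful only if
  \<open>\<gamma> t\<close> lies in the domain of \<open>c\<close>.\<close>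

definition field_along ::
    "('p, 'e::euclidean_space) chart set \<Rightarrow> (real \<Rightarrow> 'p) \<Rightarrow>
      (('p, 'e) chart \<Rightarrow> real \<Rightarrow> 'e) \<Rightarrow> bool" where
  "field_along atlas \<gamma> J \<longleftrightarrow>
     (\<forall>c\<in>atlas. smooth_on (J c) (\<gamma> -` fst c)) \<and>
     (\<forall>c\<in>atlas. \<forall>d\<in>atlas. \<forall>t. \<gamma> t \<in> fst c \<inter> fst d \<longrightarrow>
        J d t = tangent_map id c d (\<gamma> t) (J c t))"

definition vanishes_at ::
    "('p, 'e::euclidean_space) chart set \<Rightarrow> (real \<Rightarrow> 'p) \<Rightarrow>
      (('p, 'e) chart \<Rightarrow> real \<Rightarrow> 'e) \<Rightarrow> real \<Rightarrow> bool" where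
  "vanishes_at atlas \<gamma> J t \<longleftrightarrow> (\<forall>c\<in>atlas. \<gamma> t \<in> fst c \<longrightarrow> J c t = 0)"

definition jacobi_field ::
    "('p, 'e::euclidean_space) chart set \<Rightarrow> ('p, 'e) metric_field \<Rightarrow> (real \<Rightarrow> 'p) \<Rightarrow>
      (('p, 'e) chart \<Rightarrow> real \<Rightarrow> 'e) \<Rightarrow> bool" where
  "jacobi_field atlas g \<gamma> J \<longleftrightarrow> field_along atlas \<gamma> J \<and>
     (\<forall>c\<in>atlas. \<forall>t. \<gamma> t \<in> fst c \<longrightarrow>
        cov_deriv (g c) (snd c \<circ> \<gamma>) (cov_deriv (g c) (snd c \<circ> \<gamma>) (J c)) t
        + curvature (g c) (snd c (\<gamma> t)) (J c t) (velocity \<gamma> c t) (velocity \<gamma> c t) = 0)"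

definition has_conjugate_point ::
    "('p, 'e::euclidean_space) chart set \<Rightarrow> ('p, 'e) metric_field \<Rightarrow> (real \<Rightarrow> 'p) \<Rightarrow> bool" where
  "has_conjugate_point atlas g \<gamma> \<longleftrightarrow>
     (\<exists>J. jacobi_field atlas g \<gamma> J \<and> (\<exists>t. \<not> vanishes_at atlas \<gamma> J t) \<and>
        vanishes_at atlas \<gamma> J 0 \<and> (\<exists>t>0. vanishes_at atlas \<gamma> J t))"


section \<open>Lie groups\<close>

locale lie_group = smooth_manifold atlas + Groups.group gmul ident ginv
  for atlas :: "('p::{t2_space, second_countable_topology}, 'e::euclidean_space) chart set"
    and gmul :: "'p \<Rightarrow> 'p \<Rightarrow> 'p" and ident :: 'p and ginv :: "'p \<Rightarrow> 'p" +
  assumes mult_continuous: "continuous_on UNIV (\<lambda>(p, q). gmul p q)"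
    and inverse_continuous: "continuous_on UNIV ginv"
    and mult_smooth: "b \<in> atlas \<Longrightarrow> c \<in> atlas \<Longrightarrow> d \<in> atlas \<Longrightarrow>
      smooth_on (\<lambda>(x, y). snd d (gmul (inv_chart b x) (inv_chart c y)))
        {(x, y). x \<in> image_of b \<and> y \<in> image_of c \<and> gmul (inv_chart b x) (inv_chart c y) \<in> fst d}"
    and inverse_smooth: "c \<in> atlas \<Longrightarrow> d \<in> atlas \<Longrightarrow>
      smooth_on (\<lambda>x. snd d (ginv (inv_chart c x)))
        {x \<in> image_of c. ginv (inv_chart c x) \<in> fst d}"

definition left_invariant_metric ::
    "('p, 'e::euclidean_space) chart set \<Rightarrow> ('p \<Rightarrow> 'p \<Rightarrow> 'p) \<Rightarrow> ('p, 'e) metric_field \<Rightarrow> bool" where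
  "left_invariant_metric atlas gmul g \<longleftrightarrow> riemannian_metric atlas g \<and>
     (\<forall>a. \<forall>c\<in>atlas. \<forall>d\<in>atlas. \<forall>p. p \<in> fst c \<and> gmul a p \<in> fst d \<longrightarrow>
        (\<forall>v w. g d (snd d (gmul a p)) (tangent_map (gmul a) c d p v) (tangent_map (gmul a) c d p w)
                 = g c (snd c p) v w))"

text \<open>The Lie algebra is the tangent space at the identity, with the bracket of left-invariant
  vector fields. It is identified with the model space \<open>'e\<close> by means of a chart \<open>c\<close> around the
  identity. \<open>left_field gmul ident c u\<close> is the left-invariant vector field with value \<open>u\<close> at the
  identity, in the coordinates of \<open>c\<close>.\<close>

definition left_field ::
    "('p \<Rightarrow> 'p \<Rightarrow> 'p) \<Rightarrow> 'p \<Rightarrow> ('p, 'e::euclidean_space) chart \<Rightarrow> 'e \<Rightarrow> 'e \<Rightarrow> 'e" where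
  "left_field gmul ident c u x = tangent_map (gmul (inv_chart c x)) c c ident u"

text \<open>The bracket \<open>[X,Y] = XY - YX\<close> of vector fields on an open subset of \<open>'e\<close>.\<close>

definition field_bracket ::
    "('e::euclidean_space \<Rightarrow> 'e) \<Rightarrow> ('e \<Rightarrow> 'e) \<Rightarrow> 'e \<Rightarrow> 'e" where
  "field_bracket X Y x =
     frechet_derivative Y (at x) (X x) - frechet_derivative X (at x) (Y x)"

definition lie_ad ::
    "('p \<Rightarrow> 'p \<Rightarrow> 'p) \<Rightarrow> 'p \<Rightarrow> ('p, 'e::euclidean_space) chart \<Rightarrow> 'e \<Rightarrow> 'e \<Rightarrow> 'e" where
  "lie_ad gmul ident c u w =
     field_bracket (left_field gmul ident c u) (left_field gmul ident c w) (snd c ident)"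

text \<open>\<open>ip (ad\<^sup>* u v) w = ip v (ad u w)\<close> for all \<open>w\<close>.\<close>

definition lie_ad_star ::
    "('p \<Rightarrow> 'p \<Rightarrow> 'p) \<Rightarrow> 'p \<Rightarrow> ('p, 'e::euclidean_space) chart \<Rightarrow> ('p, 'e) metric_field \<Rightarrow>
      'e \<Rightarrow> 'e \<Rightarrow> 'e" where
  "lie_ad_star gmul ident c g u v =
     riesz (g c (snd c ident)) (\<lambda>w. g c (snd c ident) v (lie_ad gmul ident c u w))"


section \<open>Operators on a subspace\<close>

definition operator_on :: "'e::real_vector set \<Rightarrow> ('e \<Rightarrow> 'e) \<Rightarrow> bool" where
  "operator_on \<Omega> T \<longleftrightarrow> (\<forall>v\<in>\<Omega>. T v \<in> \<Omega>) \<and>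
     (\<forall>v\<in>\<Omega>. \<forall>w\<in>\<Omega>. T (v + w) = T v + T w) \<and> (\<forall>r. \<forall>v\<in>\<Omega>. T (r *\<^sub>R v) = r *\<^sub>R T v)"

definition op_exp :: "('e::real_normed_vector \<Rightarrow> 'e) \<Rightarrow> 'e \<Rightarrow> 'e" where
  "op_exp T v = (\<Sum>n. (T ^^ n) v /\<^sub>R fact n)"

text \<open>The determinant of the matrix of \<open>T\<close> in a basis of \<open>\<Omega>\<close>; it does not depend on the basis
  chosen.\<close>

definition det_on :: "'e::euclidean_space set \<Rightarrow> ('e \<Rightarrow> 'e) \<Rightarrow> real" where
  "det_on \<Omega> T =
     (let bs = (SOME bs. distinct bs \<and> independent (set bs) \<and> span (set bs) = \<Omega>); n = length bs
      in Determinant.det (Matrix.mat n n (\<lambda>(i, j). representation (set bs) (T (bs ! j)) (bs ! i))))"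

end

theory Submission
  imports Defs
begin

text \<open>In every chart the left-invariant fields form a frame \<open>E\<close> with constant metric coefficients
  and structure constants. In this frame the Levi-Civita connection and its curvature are algebraic
  in \<open>ad\<close> and \<open>ad\<^sup>*\<close>. The left-translated velocity of a geodesic satisfies \<open>u' = ad\<^sup>*\<^sub>u u\<close>, so
  \<open>ad\<^sup>*\<^bsub>u\<^sub>0\<^esub> u\<^sub>0 = 0\<close> forces \<open>u = u\<^sub>0\<close> along \<open>\<gamma>\<close>, and the Jacobi equation for the left translate of
  \<open>y\<close> splits into \<open>y' + A y = z\<close> and \<open>z' = F z\<close>. Since \<open>SF + AS = I\<close> makes \<open>e\<^sup>t\<^sup>A e\<^sup>t\<^sup>F\<close> the
  derivative of \<open>e\<^sup>t\<^sup>A S e\<^sup>t\<^sup>F\<close>, the solution with \<open>y 0 = 0\<close> and \<open>z 0 = z\<^sub>0 \<in> \<Omega>\<close> is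
  \<open>e\<^sup>-\<^sup>t\<^sup>A (e\<^sup>t\<^sup>A S e\<^sup>t\<^sup>F - S) z\<^sub>0\<close>, which vanishes at \<open>\<tau>\<close> for \<open>z\<^sub>0\<close> in the kernel of
  \<open>e\<^sup>\<tau>\<^sup>A S e\<^sup>\<tau>\<^sup>F - S\<close>.\<close>

section \<open>Calculus of smooth maps\<close>

text \<open>The obstacle is that all geometry is given by components in charts, and a Jacobi field
  must satisfy its equation in each of them, while \<open>A\<close>, \<open>F\<close> and
  \<open>S\<close> act on the tangent space at the identity. On left-invariant fields Koszul's
  formula loses all derivatives of the metric and leaves the connection
  \<open>B v w = (ad v w - ad* v w - ad* w v) / 2\<close>. Steadiness means
  \<open>B u\<^sub>0 u\<^sub>0 = 0\<close>; together with vanishing torsion this makes the second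
  covariant derivative plus the curvature term collapse to \<open>z' - F z\<close> with
  \<open>z = y' + A y\<close>. The geodesic is given and not built as a one-parameter subgroup, so
  the constancy of its translated velocity is a uniqueness statement for a quadratic equation. A
  Gronwall estimate on compact intervals settles it, because \<open>ad* u u\<close> vanishes at
  \<open>u = u\<^sub>0\<close>. No existence theorem for differential equations is involved: the
  Jacobi field is written with power series. Since \<open>S\<close> is controlled only on
  \<open>\<Omega>\<close>, the exponentials must be kept inside \<open>\<Omega>\<close>. The field
  is nontrivial because \<open>y = 0\<close> at all times would force \<open>z = 0\<close>, hence
  \<open>z\<^sub>0 = 0\<close>.\<close>

lemma has_derivative_frechet:
  "f differentiable (at x) \<Longrightarrow> (f has_derivative frechet_derivative f (at x)) (at x)"
  by (simp add: frechet_derivative_works)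

lemma frechet_derivative_eq:
  "(f has_derivative f') (at x) \<Longrightarrow> frechet_derivative f (at x) = f'"
  using frechet_derivative_at by metis

text \<open>A derivative at a point sees only a neighbourhood, which openness of \<open>U\<close>
  provides. Functions vary in the induction because it passes to directional derivatives.\<close>

lemma Ck_on_cong:
  assumes "open U" "Ck_on k f U" "\<And>x. x \<in> U \<Longrightarrow> f x = g x"
  shows "Ck_on k g U"
  using assms(2,3)
proof (induction k arbitrary: f g)
  case 0
  then show ?case using continuous_on_cong by (metis Ck_on.simps(1))
next
  case (Suc k)
  have g: "(g has_derivative frechet_derivative f (at x)) (at x)" if "x \<in> U" for x
    using Suc.prems(1) that
      has_derivative_transform_within_open[OF has_derivative_frechet \<open>open U\<close> that Suc.prems(2)]
    by simp
  have "Ck_on k (\<lambda>x. frechet_derivative g (at x) v) U" for v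
    by (rule Suc.IH[of "\<lambda>x. frechet_derivative f (at x) v"])
      (use Suc.prems(1) in \<open>simp_all add: frechet_derivative_eq[OF g]\<close>)
  then show ?case using g by (auto simp: differentiable_def)
qed

lemma Ck_on_Suc_intro:
  assumes "open U" "\<And>x. x \<in> U \<Longrightarrow> (f has_derivative D x) (at x)"
    and "\<And>v. Ck_on k (\<lambda>x. D x v) U"
  shows "Ck_on (Suc k) f U"
proof -
  have "Ck_on k (\<lambda>x. frechet_derivative f (at x) v) U" for v
    by (rule Ck_on_cong[OF assms(1,3)]) (simp add: frechet_derivative_eq[OF assms(2)])
  then show ?thesis using assms(2) by (auto simp: differentiable_def)
qed

lemma Ck_on_has_derivative:
  "Ck_on (Suc k) f U \<Longrightarrow> x \<in> U \<Longrightarrow> (f has_derivative frechet_derivative f (at x)) (at x)"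
  using has_derivative_frechet by auto

lemma Ck_on_Suc_le: "Ck_on (Suc k) f U \<Longrightarrow> Ck_on k f U"
proof (induction k arbitrary: f)
  case 0
  then show ?case
    by (auto intro!: continuous_at_imp_continuous_on differentiable_imp_continuous_within)
next
  case (Suc k)
  have "Ck_on k (\<lambda>x. frechet_derivative f (at x) v) U" for v
    using Suc.prems by (intro Suc.IH) (subst (asm) Ck_on.simps(2), blast)
  moreover have "\<forall>x\<in>U. f differentiable (at x)" using Suc.prems by simp
  ultimately show ?case by (subst Ck_on.simps(2)) blast
qed

lemma Ck_on_subset: "Ck_on k f U \<Longrightarrow> V \<subseteq> U \<Longrightarrow> Ck_on k f V"
  by (induction k arbitrary: f) (auto intro: continuous_on_subset)

lemma Ck_on_const: "Ck_on k (\<lambda>x. c) U"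
  by (induction k arbitrary: c) auto

lemma Ck_on_add:
  assumes "open U" "Ck_on k f U" "Ck_on k g U"
  shows "Ck_on k (\<lambda>x. f x + g x) U"
  using assms(2,3)
proof (induction k arbitrary: f g)
  case 0
  then show ?case by (simp add: continuous_on_add)
next
  case (Suc k)
  show ?case
    by (rule Ck_on_Suc_intro[OF \<open>open U\<close>
          has_derivative_add[OF Ck_on_has_derivative[OF Suc.prems(1)] Ck_on_has_derivative[OF Suc.prems(2)]]])
      (use Suc in auto)
qed

text \<open>Each summand of the product rule pairs one derivative with one undifferentiated factor,
  so the induction step also lowers the order of \<open>f\<close> and \<open>g\<close> by
  \<open>Ck_on_Suc_le\<close>.\<close>

lemma Ck_on_bounded_bilinear:
  assumes "bounded_bilinear pr" "open U" "Ck_on k f U" "Ck_on k g U"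
  shows "Ck_on k (\<lambda>x. pr (f x) (g x)) U"
  using assms(3,4)
proof (induction k arbitrary: f g)
  case 0
  then show ?case by (simp add: bounded_bilinear.continuous_on[OF assms(1)])
next
  case (Suc k)
  show ?case
    by (rule Ck_on_Suc_intro[OF \<open>open U\<close> bounded_bilinear.FDERIV[OF assms(1)
           Ck_on_has_derivative[OF Suc.prems(1)] Ck_on_has_derivative[OF Suc.prems(2)]]])
      (use Suc Ck_on_Suc_le[OF Suc.prems(1)] Ck_on_Suc_le[OF Suc.prems(2)] \<open>open U\<close>
        in \<open>auto intro!: Ck_on_add\<close>)
qed

lemma Ck_on_bounded_linear:
  assumes "bounded_linear L" "open U" "Ck_on k f U"
  shows "Ck_on k (\<lambda>x. L (f x)) U"
  using assms(3)
proof (induction k arbitrary: f)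
  case 0
  then show ?case by (simp add: bounded_linear.continuous_on[OF assms(1)])
next
  case (Suc k)
  show ?case
    by (rule Ck_on_Suc_intro[OF \<open>open U\<close> bounded_linear.has_derivative[OF assms(1)
           Ck_on_has_derivative[OF Suc.prems(1)]]])
      (use Suc in auto)
qed

lemma Ck_on_ident: "Ck_on k (\<lambda>x. x) U"
  by (cases k) (auto simp: Ck_on_const)

lemma Ck_on_sum:
  assumes "open U" "finite I" "\<And>i. i \<in> I \<Longrightarrow> Ck_on k (f i) U"
  shows "Ck_on k (\<lambda>x. \<Sum>i\<in>I. f i x) U"
  using assms(2,3) by (induction I rule: finite_induct) (auto simp: Ck_on_const intro!: Ck_on_add assms(1))

lemma Ck_on_compose:
  fixes f :: "'b::euclidean_space \<Rightarrow> 'c::real_normed_vector" and g :: "'a::euclidean_space \<Rightarrow> 'b"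
  assumes "open U" "open V" "Ck_on k f U" "Ck_on k g V" "g ` V \<subseteq> U"
  shows "Ck_on k (\<lambda>x. f (g x)) V"
  using assms(3,4)
proof (induction k arbitrary: f)
  case 0
  then show ?case using continuous_on_compose2[of U f V g] assms(5) by simp
next
  case (Suc k)
  \<comment> \<open>The chain rule applies the derivative of \<open>f\<close> to a vector that moves
    with \<open>x\<close>, whereas \<open>Ck_on\<close> speaks of fixed directions only. Expanding
    that vector in \<open>Basis\<close> leaves fixed directions \<open>b\<close> with scalar
    coefficients.\<close>
  let ?D = "\<lambda>x v. \<Sum>b\<in>Basis. (frechet_derivative g (at x) v \<bullet> b) *\<^sub>R frechet_derivative f (at (g x)) b"
  have df: "(f has_derivative frechet_derivative f (at (g x))) (at (g x))" if "x \<in> V" for x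
    using Suc.prems(1) that assms(5) by (intro Ck_on_has_derivative) auto
  have "((\<lambda>x. f (g x)) has_derivative ?D x) (at x)" if "x \<in> V" for x
  proof -
    have "linear (frechet_derivative f (at (g x)))"
      using df[OF that] has_derivative_linear by blast
    then have "?D x = (\<lambda>v. frechet_derivative f (at (g x)) (frechet_derivative g (at x) v))"
      using linear_sum[of "frechet_derivative f (at (g x))" "\<lambda>b. (frechet_derivative g (at x) v \<bullet> b) *\<^sub>R b" Basis for v]
      by (simp add: linear_scale euclidean_representation fun_eq_iff)
    then show ?thesis
      using has_derivative_compose[OF Ck_on_has_derivative[OF Suc.prems(2) that] df[OF that]] by simp
  qed
  moreover have "Ck_on k (\<lambda>x. ?D x v) V" for v
  proof (intro Ck_on_sum[OF \<open>open V\<close>] Ck_on_bounded_bilinear[OF bounded_bilinear_scaleR \<open>open V\<close>] finite_Basis)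
    fix b :: 'b
    show "Ck_on k (\<lambda>x. frechet_derivative g (at x) v \<bullet> b) V"
      using Suc.prems(2) by (intro Ck_on_bounded_linear[OF bounded_linear_inner_left \<open>open V\<close>]) auto
    show "Ck_on k (\<lambda>x. frechet_derivative f (at (g x)) b) V"
      using Suc.prems Ck_on_Suc_le[OF Suc.prems(2)] by (intro Suc.IH) auto
  qed
  ultimately show ?case
    by (intro Ck_on_Suc_intro[OF \<open>open V\<close>])
qed

lemma smooth_on_cong:
  "open U \<Longrightarrow> smooth_on f U \<Longrightarrow> (\<And>x. x \<in> U \<Longrightarrow> f x = g x) \<Longrightarrow> smooth_on g U"
  unfolding smooth_on_def using Ck_on_cong by blast

lemma smooth_on_subset: "smooth_on f U \<Longrightarrow> V \<subseteq> U \<Longrightarrow> smooth_on f V"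
  unfolding smooth_on_def using Ck_on_subset by blast

lemma smooth_on_const: "smooth_on (\<lambda>x. c) U"
  by (simp add: smooth_on_def Ck_on_const)

lemma smooth_on_bounded_linear:
  "bounded_linear L \<Longrightarrow> open U \<Longrightarrow> smooth_on f U \<Longrightarrow> smooth_on (\<lambda>x. L (f x)) U"
  unfolding smooth_on_def using Ck_on_bounded_linear by blast

lemma smooth_on_bounded_bilinear:
  "bounded_bilinear pr \<Longrightarrow> open U \<Longrightarrow> smooth_on f U \<Longrightarrow> smooth_on g U
    \<Longrightarrow> smooth_on (\<lambda>x. pr (f x) (g x)) U"
  unfolding smooth_on_def using Ck_on_bounded_bilinear by blast

lemma smooth_on_add:
  "open U \<Longrightarrow> smooth_on f U \<Longrightarrow> smooth_on g U \<Longrightarrow> smooth_on (\<lambda>x. f x + g x) U"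
  unfolding smooth_on_def using Ck_on_add by blast

lemma smooth_on_diff:
  "open U \<Longrightarrow> smooth_on f U \<Longrightarrow> smooth_on g U \<Longrightarrow> smooth_on (\<lambda>x. f x - g x) U"
  using smooth_on_add[of U f "\<lambda>x. - g x"]
    smooth_on_bounded_linear[OF bounded_linear_minus[OF bounded_linear_ident], of U g] by simp

lemma smooth_on_sum:
  "open U \<Longrightarrow> finite I \<Longrightarrow> (\<And>i. i \<in> I \<Longrightarrow> smooth_on (f i) U) \<Longrightarrow> smooth_on (\<lambda>x. \<Sum>i\<in>I. f i x) U"
  unfolding smooth_on_def using Ck_on_sum by blast

lemma smooth_on_compose:
  fixes f :: "'b::euclidean_space \<Rightarrow> 'c::real_normed_vector" and g :: "'a::euclidean_space \<Rightarrow> 'b"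
  shows "open U \<Longrightarrow> open V \<Longrightarrow> smooth_on f U \<Longrightarrow> smooth_on g V \<Longrightarrow> g ` V \<subseteq> U
    \<Longrightarrow> smooth_on (\<lambda>x. f (g x)) V"
  unfolding smooth_on_def using Ck_on_compose by blast

lemma smooth_on_ident: "smooth_on (\<lambda>x. x) U"
  by (simp add: smooth_on_def Ck_on_ident)

lemma smooth_on_Pair:
  assumes "open U" "smooth_on f U" "smooth_on g U"
  shows "smooth_on (\<lambda>x. (f x, g x)) U"
proof -
  have l: "bounded_linear (\<lambda>a. (a, 0))" "bounded_linear (\<lambda>b. (0, b))"
    by (auto intro!: bounded_linear_Pair bounded_linear_ident bounded_linear_zero)
  show ?thesis
    using smooth_on_add[OF assms(1) smooth_on_bounded_linear[OF l(1) assms(1,2)]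
        smooth_on_bounded_linear[OF l(2) assms(1,3)]] by simp
qed

lemma smooth_on_has_derivative:
  "smooth_on f U \<Longrightarrow> x \<in> U \<Longrightarrow> (f has_derivative frechet_derivative f (at x)) (at x)"
  unfolding smooth_on_def using Ck_on_has_derivative by blast

lemma smooth_on_differentiable: "smooth_on f U \<Longrightarrow> x \<in> U \<Longrightarrow> f differentiable (at x)"
  using smooth_on_has_derivative differentiable_def by blast

lemma smooth_on_frechet_derivative:
  "smooth_on f U \<Longrightarrow> smooth_on (\<lambda>x. frechet_derivative f (at x) v) U"
  unfolding smooth_on_def using Ck_on.simps(2) by blast

lemma smooth_on_continuous_on: "smooth_on f U \<Longrightarrow> continuous_on U f"
  unfolding smooth_on_def using Ck_on.simps(1) by blast

section \<open>Symmetry of second derivatives\<close>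

lemma symmetric_second_difference:
  fixes f :: "'a::real_normed_vector \<Rightarrow> real"
  assumes h: "h > 0"
    and S: "\<And>s t. 0 \<le> s \<Longrightarrow> s \<le> h \<Longrightarrow> 0 \<le> t \<Longrightarrow> t \<le> h \<Longrightarrow> x + s *\<^sub>R v + t *\<^sub>R w \<in> S"
    and D: "\<And>y. y \<in> S \<Longrightarrow> (f has_derivative D y) (at y)"
    and P: "\<And>y. y \<in> S \<Longrightarrow> ((\<lambda>y. D y v) has_derivative P y) (at y)"
  shows "\<exists>y\<in>S. f (x + h *\<^sub>R v + h *\<^sub>R w) - f (x + h *\<^sub>R v) - (f (x + h *\<^sub>R w) - f x) = h\<^sup>2 * P y w"
proof -
  \<comment> \<open>The second difference over the parallelogram is the increment of
    \<open>\<phi>\<close>. One mean value step along \<open>v\<close> turns it into an increment of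
    the derivative in direction \<open>v\<close>, and a second one along \<open>w\<close> into a
    mixed derivative.\<close>
  define \<phi> where "\<phi> s = f (x + s *\<^sub>R v + h *\<^sub>R w) - f (x + s *\<^sub>R v)" for s
  have lD: "D y (r *\<^sub>R z) = r * D y z" if "y \<in> S" for y r z
    using linear_scale[OF has_derivative_linear[OF D[OF that]]] by simp
  have lP: "P y (r *\<^sub>R z) = r * P y z" if "y \<in> S" for y r z
    using linear_scale[OF has_derivative_linear[OF P[OF that]]] by simp
  have d\<phi>: "(\<phi> has_real_derivative (D (x + s *\<^sub>R v + h *\<^sub>R w) v - D (x + s *\<^sub>R v) v)) (at s)"
    if s: "0 \<le> s" "s \<le> h" for s
  proof -
    have 1: "x + s *\<^sub>R v + h *\<^sub>R w \<in> S" and 2: "x + s *\<^sub>R v \<in> S" using S[of s h] S[of s 0] s h by auto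
    have "((\<lambda>s. f (x + s *\<^sub>R v + h *\<^sub>R w)) has_derivative (\<lambda>r. D (x + s *\<^sub>R v + h *\<^sub>R w) (r *\<^sub>R v))) (at s)"
      by (rule has_derivative_compose[of "\<lambda>s. x + s *\<^sub>R v + h *\<^sub>R w" _ s UNIV, OF _ D[OF 1]]) (auto intro!: derivative_eq_intros)
    moreover have "((\<lambda>s. f (x + s *\<^sub>R v)) has_derivative (\<lambda>r. D (x + s *\<^sub>R v) (r *\<^sub>R v))) (at s)"
      by (rule has_derivative_compose[of "\<lambda>s. x + s *\<^sub>R v" _ s UNIV, OF _ D[OF 2]]) (auto intro!: derivative_eq_intros)
    ultimately have "(\<phi> has_derivative
        (\<lambda>r. D (x + s *\<^sub>R v + h *\<^sub>R w) (r *\<^sub>R v) - D (x + s *\<^sub>R v) (r *\<^sub>R v))) (at s)"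
      unfolding \<phi>_def by (rule has_derivative_diff)
    moreover have "(\<lambda>r. D (x + s *\<^sub>R v + h *\<^sub>R w) (r *\<^sub>R v) - D (x + s *\<^sub>R v) (r *\<^sub>R v))
        = (*) (D (x + s *\<^sub>R v + h *\<^sub>R w) v - D (x + s *\<^sub>R v) v)"
      by (rule ext) (simp only: lD[OF 1] lD[OF 2] right_diff_distrib mult.commute)
    ultimately show ?thesis
      unfolding has_field_derivative_def by simp
  qed
  obtain s where s: "0 < s" "s < h"
    and 1: "\<phi> h - \<phi> 0 = (h - 0) * (D (x + s *\<^sub>R v + h *\<^sub>R w) v - D (x + s *\<^sub>R v) v)"
    using MVT2[OF h d\<phi>] by blast
  define \<psi> where "\<psi> t = D (x + s *\<^sub>R v + t *\<^sub>R w) v" for t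
  have d\<psi>: "(\<psi> has_real_derivative P (x + s *\<^sub>R v + t *\<^sub>R w) w) (at t)" if t: "0 \<le> t" "t \<le> h" for t
  proof -
    have 1: "x + s *\<^sub>R v + t *\<^sub>R w \<in> S" using S[of s t] s t by auto
    have "(\<psi> has_derivative (\<lambda>r. P (x + s *\<^sub>R v + t *\<^sub>R w) (r *\<^sub>R w))) (at t)"
      unfolding \<psi>_def by (rule has_derivative_compose[of "\<lambda>t. x + s *\<^sub>R v + t *\<^sub>R w" _ t UNIV, OF _ P[OF 1]]) (auto intro!: derivative_eq_intros)
    then show ?thesis unfolding has_field_derivative_def by (simp add: lP 1 mult_commute_abs)
  qed
  obtain t where t: "0 < t" "t < h" and 2: "\<psi> h - \<psi> 0 = (h - 0) * P (x + s *\<^sub>R v + t *\<^sub>R w) w"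
    using MVT2[OF h d\<psi>] by blast
  have "\<phi> h - \<phi> 0 = h\<^sup>2 * P (x + s *\<^sub>R v + t *\<^sub>R w) w"
    using 1 2 by (simp add: \<psi>_def power2_eq_square)
  then show ?thesis
    using S[of s t] s t by (intro bexI[of _ "x + s *\<^sub>R v + t *\<^sub>R w"]) (auto simp: \<phi>_def)
qed

lemma symmetric_second_derivative_real:
  fixes f :: "'a::euclidean_space \<Rightarrow> real"
  assumes U: "open U" "x \<in> U" and f: "smooth_on f U"
  shows "frechet_derivative (\<lambda>y. frechet_derivative f (at y) v) (at x) w
       = frechet_derivative (\<lambda>y. frechet_derivative f (at y) w) (at x) v"
proof (rule ccontr)
  define P where "P v w y = frechet_derivative (\<lambda>y. frechet_derivative f (at y) v) (at y) w" for v w y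
  assume "\<not> ?thesis"
  then have "P v w x \<noteq> P w v x" by (simp add: P_def)
  \<comment> \<open>Half the gap: values strictly within \<open>e\<close> of the two mixed
    derivatives at \<open>x\<close> cannot coincide. Yet the second difference is symmetric in
    \<open>v\<close> and \<open>w\<close>, so both orders of differentiation share a value near
    \<open>x\<close>.\<close>
  define e where "e = \<bar>P v w x - P w v x\<bar> / 2"
  have "e > 0" using \<open>P v w x \<noteq> P w v x\<close> by (simp add: e_def)
  have cont: "isCont (P a b) x" for a b
    using smooth_on_continuous_on[OF smooth_on_frechet_derivative[OF smooth_on_frechet_derivative[OF f]]] U
    unfolding P_def using continuous_on_eq_continuous_at by blast
  obtain d1 where d1: "d1 > 0" "\<And>y. dist y x < d1 \<Longrightarrow> dist (P v w y) (P v w x) < e"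
    using cont[of v w] \<open>e > 0\<close> by (metis continuous_at_eps_delta cont dist_commute)
  obtain d2 where d2: "d2 > 0" "\<And>y. dist y x < d2 \<Longrightarrow> dist (P w v y) (P w v x) < e"
    using \<open>e > 0\<close> by (metis continuous_at_eps_delta cont dist_commute)
  obtain d3 where d3: "d3 > 0" "ball x d3 \<subseteq> U" using U openE by blast
  define d where "d = min d1 (min d2 d3)"
  have "d > 0" using d1 d2 d3 by (simp add: d_def)
  \<comment> \<open>This keeps the whole parallelogram within \<open>d / 2\<close> of
    \<open>x\<close>; the summand 1 guards against \<open>v = w = 0\<close>.\<close>
  define h where "h = d / 2 / (norm v + norm w + 1)"
  have pos: "norm v + norm w + 1 > 0" by (smt (verit) norm_ge_zero)
  have "h > 0" using \<open>d > 0\<close> pos by (simp add: h_def)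
  have S: "x + s *\<^sub>R a + t *\<^sub>R b \<in> ball x d"
    if "0 \<le> s" "s \<le> h" "0 \<le> t" "t \<le> h" "{a, b} = {v, w}" for s t a b
  proof -
    have "norm (s *\<^sub>R a + t *\<^sub>R b) \<le> h * norm a + h * norm b"
      using that by (intro order.trans[OF norm_triangle_ineq] add_mono) (auto intro!: mult_right_mono)
    also have "\<dots> \<le> h * (norm v + norm w + 1)"
      using that(5) \<open>h > 0\<close> by (auto simp: doubleton_eq_iff algebra_simps)
    also have "\<dots> = d / 2" using pos by (simp add: h_def del: divide_divide_eq_left)
    also have "\<dots> < d" using \<open>d > 0\<close> by simp
    finally have "dist (x + s *\<^sub>R a + t *\<^sub>R b) x < d" by (simp add: dist_norm add.assoc)
    then show ?thesis by (simp add: dist_commute)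
  qed
  have B: "y \<in> U" "dist y x < d1" "dist y x < d2" if "y \<in> ball x d" for y
    using that d3 by (auto simp: d_def dist_commute)
  have D1: "(f has_derivative frechet_derivative f (at y)) (at y)" if "y \<in> ball x d" for y
    using smooth_on_has_derivative[OF f] B[OF that] by simp
  have D2: "((\<lambda>y. frechet_derivative f (at y) a) has_derivative (\<lambda>b. P a b y)) (at y)"
    if "y \<in> ball x d" for y a
    using smooth_on_has_derivative[OF smooth_on_frechet_derivative[OF f]] B[OF that] by (simp add: P_def)
  obtain y where y: "y \<in> ball x d"
    "f (x + h *\<^sub>R v + h *\<^sub>R w) - f (x + h *\<^sub>R v) - (f (x + h *\<^sub>R w) - f x) = h\<^sup>2 * P v w y"
    using symmetric_second_difference[OF \<open>h > 0\<close> S D1 D2, of v w] by auto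
  obtain z where z: "z \<in> ball x d"
    "f (x + h *\<^sub>R w + h *\<^sub>R v) - f (x + h *\<^sub>R w) - (f (x + h *\<^sub>R v) - f x) = h\<^sup>2 * P w v z"
    using symmetric_second_difference[OF \<open>h > 0\<close> S D1 D2, of w v] by (auto simp: insert_commute)
  have "h\<^sup>2 * P v w y = h\<^sup>2 * P w v z"
    using y(2) z(2) by (simp add: algebra_simps)
  then have "P v w y = P w v z" using \<open>h > 0\<close> by simp
  then show False
    using d1(2)[of y] d2(2)[of z] B y z unfolding e_def dist_real_def by (smt (verit) field_sum_of_halves)
qed

lemma symmetric_second_derivative:
  fixes f :: "'a::euclidean_space \<Rightarrow> 'b::euclidean_space"
  assumes U: "open U" "x \<in> U" and f: "smooth_on f U"
  shows "frechet_derivative (\<lambda>y. frechet_derivative f (at y) v) (at x) w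
       = frechet_derivative (\<lambda>y. frechet_derivative f (at y) w) (at x) v"
proof (rule euclidean_eqI)
  fix b :: 'b
  have 1: "frechet_derivative (\<lambda>y. f y \<bullet> b) (at y) v = frechet_derivative f (at y) v \<bullet> b"
    if "y \<in> U" for y v
    by (rule fun_cong[OF frechet_derivative_eq]) (intro has_derivative_inner_left smooth_on_has_derivative[OF f that])
  have 2: "frechet_derivative (\<lambda>y. frechet_derivative (\<lambda>y. f y \<bullet> b) (at y) v) (at x) w
     = frechet_derivative (\<lambda>y. frechet_derivative f (at y) v) (at x) w \<bullet> b" for v w
    by (rule fun_cong[OF frechet_derivative_eq], rule has_derivative_transform_within_open[OF _ U])
     (auto simp: 1 intro!: has_derivative_inner_left smooth_on_has_derivative[OF smooth_on_frechet_derivative[OF f] U(2)])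
  show "frechet_derivative (\<lambda>y. frechet_derivative f (at y) v) (at x) w \<bullet> b
       = frechet_derivative (\<lambda>y. frechet_derivative f (at y) w) (at x) v \<bullet> b"
    using symmetric_second_derivative_real[OF U, of "\<lambda>y. f y \<bullet> b" v w]
      smooth_on_bounded_linear[OF bounded_linear_inner_left U(1) f] by (simp add: 2)
qed

section \<open>Linear maps depending on a point\<close>

lemma smooth_on_linear_family:
  fixes T :: "'d::euclidean_space \<Rightarrow> 'e::euclidean_space \<Rightarrow> 'f::real_normed_vector"
  assumes "open U" "\<And>y. y \<in> U \<Longrightarrow> linear (T y)"
    and "\<And>v. smooth_on (\<lambda>y. T y v) U" "smooth_on f U"
  shows "smooth_on (\<lambda>y. T y (f y)) U"
proof (rule smooth_on_cong[OF assms(1)])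
  show "smooth_on (\<lambda>y. \<Sum>b\<in>Basis. (f y \<bullet> b) *\<^sub>R T y b) U"
    by (intro smooth_on_sum smooth_on_bounded_bilinear[OF bounded_bilinear_scaleR] assms finite_Basis
        smooth_on_bounded_linear[OF bounded_linear_inner_left])
  fix y assume "y \<in> U"
  then show "(\<Sum>b\<in>Basis. (f y \<bullet> b) *\<^sub>R T y b) = T y (f y)"
    using linear_sum[OF assms(2), of y "\<lambda>b. (f y \<bullet> b) *\<^sub>R b" Basis]
    by (simp add: linear_scale[OF assms(2)] euclidean_representation)
qed

text \<open>Linearity in \<open>v\<close> passes to the derivative in the base point by uniqueness
  of derivatives; openness makes the identities hold near \<open>x\<close>.\<close>

lemma linear_derivative_family:
  fixes T :: "'d::real_normed_vector \<Rightarrow> 'e::real_vector \<Rightarrow> 'f::real_normed_vector"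
  assumes "open U" "x \<in> U" "\<And>y. y \<in> U \<Longrightarrow> linear (T y)"
    and D: "\<And>v. ((\<lambda>y. T y v) has_derivative D v) (at x)"
  shows "linear (\<lambda>v. D v h)"
proof (rule linearI)
  fix v w and r :: real
  have "((\<lambda>y. T y (v + w)) has_derivative (\<lambda>h. D v h + D w h)) (at x)"
    by (rule has_derivative_transform_within_open[OF has_derivative_add[OF D D] assms(1,2)])
      (simp add: linear_add[OF assms(3)])
  then show "D (v + w) h = D v h + D w h"
    using has_derivative_unique[OF D] by metis
  have "((\<lambda>y. T y (r *\<^sub>R v)) has_derivative (\<lambda>h. r *\<^sub>R D v h)) (at x)"
    by (rule has_derivative_transform_within_open[OF has_derivative_scaleR_right[OF D] assms(1,2)])
      (simp add: linear_scale[OF assms(3)])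
  then show "D (r *\<^sub>R v) h = r *\<^sub>R D v h"
    using has_derivative_unique[OF D] by metis
qed

text \<open>Differentiability is known only for each fixed vector. Expansion in \<open>Basis\<close>
  reduces the claim to finitely many products, and linearity of \<open>D\<close> in its vector
  reassembles the sum. Metric, frame and Christoffel terms are all differentiated along moving
  arguments in this way.\<close>

lemma has_derivative_linear_family:
  fixes T :: "'d::real_normed_vector \<Rightarrow> 'e::euclidean_space \<Rightarrow> 'f::real_normed_vector"
  assumes "open U" "x \<in> U" "\<And>y. y \<in> U \<Longrightarrow> linear (T y)"
    and D: "\<And>v. ((\<lambda>y. T y v) has_derivative D v) (at x)"
    and f: "(f has_derivative f') (at x)"
  shows "((\<lambda>y. T y (f y)) has_derivative (\<lambda>h. D (f x) h + T x (f' h))) (at x)"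
proof (rule has_derivative_transform_within_open[OF _ assms(1,2)])
  have T: "(\<Sum>b\<in>Basis. (w \<bullet> b) *\<^sub>R T y b) = T y w" if "y \<in> U" for y w
    using linear_sum[OF assms(3), of y "\<lambda>b. (w \<bullet> b) *\<^sub>R b" Basis] that
    by (simp add: linear_scale[OF assms(3)] euclidean_representation)
  then show "(\<Sum>b\<in>Basis. (f y \<bullet> b) *\<^sub>R T y b) = T y (f y)" if "y \<in> U" for y
    using that .
  have lD: "linear (\<lambda>v. D v h)" for h
    by (rule linear_derivative_family[OF assms(1-4)])
  have D': "(\<Sum>b\<in>Basis. (w \<bullet> b) *\<^sub>R D b h) = D w h" for w h
    using linear_sum[OF lD[of h], of "\<lambda>b. (w \<bullet> b) *\<^sub>R b" Basis]
    by (simp add: linear_scale[OF lD] euclidean_representation)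
  have "((\<lambda>y. \<Sum>b\<in>Basis. (f y \<bullet> b) *\<^sub>R T y b) has_derivative
     (\<lambda>h. \<Sum>b\<in>Basis. (f x \<bullet> b) *\<^sub>R D b h + (f' h \<bullet> b) *\<^sub>R T x b)) (at x)"
    by (intro has_derivative_sum has_derivative_scaleR has_derivative_inner_left f D)
  then show "((\<lambda>y. \<Sum>b\<in>Basis. (f y \<bullet> b) *\<^sub>R T y b) has_derivative (\<lambda>h. D (f x) h + T x (f' h))) (at x)"
    by (simp add: sum.distrib D' T[OF assms(2)])
qed

section \<open>Linear differential equations and the Sylvester equation\<close>

lemma gronwall_zero_nonneg:
  fixes w :: "real \<Rightarrow> 'e::real_inner"
  assumes w: "\<And>t. (w has_vector_derivative w' t) (at t)"
    and L: "\<And>t. 0 \<le> t \<Longrightarrow> t \<le> T \<Longrightarrow> norm (w' t) \<le> L * norm (w t)"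
    and "w 0 = 0" "0 \<le> T"
  shows "w T = 0"
proof -
  \<comment> \<open>The weight absorbs the growth rate:
    \<open>(w \<bullet> w)' \<le> 2 * L * (w \<bullet> w)\<close> by Cauchy-Schwarz, so
    \<open>\<phi>\<close> decreases from its initial value 0 and is nonnegative.\<close>
  define \<phi> where "\<phi> t = (w t \<bullet> w t) * exp (- 2 * L * t)" for t
  have "\<exists>d. (\<phi> has_real_derivative d) (at t) \<and> d \<le> 0" if "0 \<le> t" "t \<le> T" for t
  proof (intro exI conjI)
    have dw: "(w has_derivative (\<lambda>h. h *\<^sub>R w' t)) (at t)"
      using w by (simp add: has_vector_derivative_def)
    have "((\<lambda>t. w t \<bullet> w t) has_derivative (\<lambda>h. w t \<bullet> h *\<^sub>R w' t + h *\<^sub>R w' t \<bullet> w t)) (at t)"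
      by (rule has_derivative_inner[OF dw dw])
    moreover have "(\<lambda>h. w t \<bullet> h *\<^sub>R w' t + h *\<^sub>R w' t \<bullet> w t) = (*) (2 * (w t \<bullet> w' t))"
      by (auto simp: inner_commute)
    ultimately have "((\<lambda>t. w t \<bullet> w t) has_real_derivative 2 * (w t \<bullet> w' t)) (at t)"
      by (simp add: has_field_derivative_def)
    note d = DERIV_mult[OF this]
    have "((\<lambda>t. exp (- 2 * L * t)) has_real_derivative exp (- 2 * L * t) * (- 2 * L)) (at t)"
      by (auto intro!: derivative_eq_intros)
    from d[OF this]
    show "(\<phi> has_real_derivative 2 * (w t \<bullet> w' t) * exp (- 2 * L * t)
        + exp (- 2 * L * t) * (- 2 * L) * (w t \<bullet> w t)) (at t)"
      unfolding \<phi>_def .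
    have "w t \<bullet> w' t \<le> norm (w t) * norm (w' t)" by (rule norm_cauchy_schwarz)
    also have "\<dots> \<le> norm (w t) * (L * norm (w t))" using L[OF that] by (intro mult_left_mono) auto
    finally have "w t \<bullet> w' t \<le> L * (w t \<bullet> w t)" by (simp add: dot_square_norm power2_eq_square mult_ac)
    then have "exp (- 2 * L * t) * (w t \<bullet> w' t) \<le> exp (- 2 * L * t) * (L * (w t \<bullet> w t))"
      by (intro mult_left_mono) auto
    then show "2 * (w t \<bullet> w' t) * exp (- 2 * L * t) + exp (- 2 * L * t) * (- 2 * L) * (w t \<bullet> w t) \<le> 0"
      by (simp add: algebra_simps)
  qed
  then have "\<phi> T \<le> \<phi> 0"
    using DERIV_nonpos_imp_nonincreasing[OF \<open>0 \<le> T\<close>, of \<phi>] by blast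
  then have "w T \<bullet> w T \<le> 0" using \<open>w 0 = 0\<close> by (simp add: \<phi>_def mult_le_0_iff)
  then show ?thesis using inner_ge_zero[of "w T"] by (metis antisym inner_eq_zero_iff)
qed

text \<open>The constant may depend on the time interval, which the quadratic Euler-Arnold equation
  requires. Negative times are handled by reflection.\<close>

lemma gronwall_zero:
  fixes w :: "real \<Rightarrow> 'e::real_inner"
  assumes w: "\<And>t. (w has_vector_derivative w' t) (at t)"
    and L: "\<And>T. \<exists>L. \<forall>t. \<bar>t\<bar> \<le> T \<longrightarrow> norm (w' t) \<le> L * norm (w t)"
    and w0: "w 0 = 0"
  shows "w t = 0"
proof (cases "t \<ge> 0")
  case True
  obtain L where "\<And>s. \<bar>s\<bar> \<le> t \<Longrightarrow> norm (w' s) \<le> L * norm (w s)" using L by blast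
  then show ?thesis by (intro gronwall_zero_nonneg[where L = L, OF w _ w0 True]) auto
next
  case False
  obtain L where L: "\<And>s. \<bar>s\<bar> \<le> - t \<Longrightarrow> norm (w' s) \<le> L * norm (w s)" using L by blast
  have nd: "((\<lambda>s. - s) has_vector_derivative - 1) (at s)" for s :: real
    by (auto intro!: derivative_eq_intros)
  have "((\<lambda>s. w (- s)) has_vector_derivative - w' (- s)) (at s)" for s
    using vector_diff_chain_at[OF nd w] by (simp add: o_def)
  then have "(\<lambda>s. w (- s)) (- t) = 0"
    by (rule gronwall_zero_nonneg[where L = L]) (use False w0 L in auto)
  then show ?thesis by simp
qed

lemma linear_ode_unique:
  fixes w :: "real \<Rightarrow> 'e::euclidean_space"
  assumes "linear M" "\<And>t. (w has_vector_derivative M (w t)) (at t)" "w 0 = 0"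
  shows "w t = 0"
proof (rule gronwall_zero[OF assms(2) _ assms(3)])
  obtain K where "\<And>x. norm (M x) \<le> K * norm x"
    using linear_bounded[OF assms(1)] by blast
  then show "\<exists>L. \<forall>t. \<bar>t\<bar> \<le> T \<longrightarrow> norm (M (w t)) \<le> L * norm (w t)" for T by blast
qed

text \<open>Bootstrapping: the equation expresses the derivative through \<open>w\<close>, so each
  order of smoothness yields the next.\<close>

lemma linear_ode_smooth:
  fixes w :: "real \<Rightarrow> 'e::euclidean_space"
  assumes "linear M" and w: "\<And>t. (w has_vector_derivative M (w t)) (at t)"
  shows "smooth_on w UNIV"
proof -
  have "Ck_on k w UNIV" for k
  proof (induction k)
    case 0
    then show ?case
      using w by (auto intro!: continuous_at_imp_continuous_on has_vector_derivative_continuous)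
  next
    case (Suc k)
    have "Ck_on k (\<lambda>t. h *\<^sub>R M (w t)) UNIV" for h
      using assms(1) Suc
      by (intro Ck_on_bounded_linear[OF bounded_linear_scaleR_right] Ck_on_bounded_linear[of M])
        (auto simp: linear_conv_bounded_linear)
    then show ?case
      using w by (intro Ck_on_Suc_intro[of UNIV w "\<lambda>t h. h *\<^sub>R M (w t)"]) (auto simp: has_vector_derivative_def)
  qed
  then show ?thesis by (simp add: smooth_on_def)
qed

section \<open>The exponential of an operator\<close>

lemma funpow_scaleR_linear:
  fixes T :: "'e::real_vector \<Rightarrow> 'e"
  assumes "linear T"
  shows "((\<lambda>w. t *\<^sub>R T w) ^^ n) v = t ^ n *\<^sub>R (T ^^ n) v"
  by (induction n) (simp_all add: linear_scale[OF assms])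

context
  fixes T :: "'e::euclidean_space \<Rightarrow> 'e"
  assumes T: "linear T"
begin

lemma op_exp_scaleR: "op_exp (\<lambda>w. t *\<^sub>R T w) v = (\<Sum>n. t ^ n *\<^sub>R ((T ^^ n) v /\<^sub>R fact n))"
  unfolding op_exp_def funpow_scaleR_linear[OF T] by (simp add: mult.commute)

lemma summable_op_exp: "summable (\<lambda>n. t ^ n *\<^sub>R ((T ^^ n) v /\<^sub>R fact n))"
proof -
  obtain K where K: "K > 0" "\<And>x. norm (T x) \<le> K * norm x"
    using linear_bounded_pos[OF T] by blast
  have "norm ((T ^^ n) v) \<le> K ^ n * norm v" for n
  proof (induction n)
    case (Suc n)
    have "norm ((T ^^ Suc n) v) \<le> K * norm ((T ^^ n) v)" using K(2) by simp
    also have "\<dots> \<le> K * (K ^ n * norm v)" using Suc K(1) by (intro mult_left_mono) auto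
    finally show ?case by simp
  qed simp
  then have "inverse (fact n) * \<bar>t\<bar> ^ n * norm ((T ^^ n) v) \<le> inverse (fact n) * \<bar>t\<bar> ^ n * (K ^ n * norm v)" for n
    by (intro mult_left_mono) auto
  then have *: "norm (t ^ n *\<^sub>R ((T ^^ n) v /\<^sub>R fact n)) \<le> inverse (fact n) * (\<bar>t\<bar> * K) ^ n * norm v" for n
    by (simp add: power_mult_distrib power_abs abs_mult mult_ac)
  have "summable (\<lambda>n. inverse (fact n) * (\<bar>t\<bar> * K) ^ n * norm v)"
    by (intro summable_mult2 summable_exp)
  then show ?thesis
    by (rule summable_comparison_test'[where N = 0]) (rule *)
qed

lemma op_exp_0: "op_exp (\<lambda>w. 0 *\<^sub>R T w) v = v"
  unfolding op_exp_scaleR by (subst suminf_finite[of "{0}"]) auto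

text \<open>The partial sums stay in \<open>\<Omega>\<close>, and a subspace is closed in finite
  dimension.\<close>

lemma op_exp_in_subspace:
  assumes \<Omega>: "subspace \<Omega>" "T ` \<Omega> \<subseteq> \<Omega>" "v \<in> \<Omega>"
  shows "op_exp (\<lambda>w. t *\<^sub>R T w) v \<in> \<Omega>"
proof -
  have "(T ^^ n) v \<in> \<Omega>" for n by (induction n) (use \<Omega> in auto)
  then have "(\<Sum>n<k. t ^ n *\<^sub>R ((T ^^ n) v /\<^sub>R fact n)) \<in> \<Omega>" for k
    by (intro subspace_sum[OF \<Omega>(1)] subspace_scale[OF \<Omega>(1)])
  then show ?thesis
    unfolding op_exp_scaleR
    using closed_sequentially[OF closed_subspace[OF \<Omega>(1)] _ summable_LIMSEQ[OF summable_op_exp]] by blast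
qed

text \<open>Each coordinate is an everywhere convergent real power series in \<open>t\<close>, which
  may be differentiated term by term.\<close>

lemma op_exp_has_vector_derivative:
  "((\<lambda>t. op_exp (\<lambda>w. t *\<^sub>R T w) v) has_vector_derivative T (op_exp (\<lambda>w. t *\<^sub>R T w) v)) (at t)"
  unfolding has_vector_derivative_def
proof (subst has_derivative_componentwise_within, intro ballI)
  fix b :: 'e
  define c where "c n = (T ^^ n) v \<bullet> b / fact n" for n
  have c: "op_exp (\<lambda>w. t *\<^sub>R T w) v \<bullet> b = (\<Sum>n. c n * t ^ n)" for t
    unfolding op_exp_scaleR c_def
    by (subst bounded_linear.suminf[OF bounded_linear_inner_left summable_op_exp])
      (simp add: divide_inverse mult_ac)
  have "summable (\<lambda>n. c n * t ^ n)" for t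
    using bounded_linear.summable[OF bounded_linear_inner_left summable_op_exp, of t v b]
    by (simp add: c_def divide_inverse mult_ac)
  then have "((\<lambda>t. \<Sum>n. c n * t ^ n) has_field_derivative (\<Sum>n. diffs c n * t ^ n)) (at t)"
    by (rule termdiffs_strong_converges_everywhere)
  moreover have "T (op_exp (\<lambda>w. t *\<^sub>R T w) v) \<bullet> b = (\<Sum>n. diffs c n * t ^ n)"
  proof -
    have "bounded_linear (\<lambda>w. T w \<bullet> b)"
      using T by (simp add: linear_conv_bounded_linear bounded_linear_inner_left_comp)
    from bounded_linear.suminf[OF this summable_op_exp, of t v]
    have "T (op_exp (\<lambda>w. t *\<^sub>R T w) v) \<bullet> b = (\<Sum>n. T (t ^ n *\<^sub>R ((T ^^ n) v /\<^sub>R fact n)) \<bullet> b)"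
      unfolding op_exp_scaleR .
    also have "(\<lambda>n. T (t ^ n *\<^sub>R ((T ^^ n) v /\<^sub>R fact n)) \<bullet> b) = (\<lambda>n. diffs c n * t ^ n)"
    proof
      fix n
      \<comment> \<open>\<open>diffs\<close> shifts the index: \<open>(n + 1) * c (n + 1)\<close>
        has the power \<open>n + 1\<close> of \<open>T\<close> over \<open>fact n\<close>, and the
        extra factor \<open>T\<close> is the generator in front of the exponential.\<close>
      have "diffs c n = T ((T ^^ n) v) \<bullet> b / fact n"
        by (simp add: diffs_def c_def del: of_nat_Suc)
      then show "T (t ^ n *\<^sub>R ((T ^^ n) v /\<^sub>R fact n)) \<bullet> b = diffs c n * t ^ n"
        by (simp add: linear_scale[OF T] divide_inverse mult_ac)
    qed
    finally show ?thesis .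
  qed
  ultimately show "((\<lambda>t. op_exp (\<lambda>w. t *\<^sub>R T w) v \<bullet> b) has_derivative
      (\<lambda>h. h *\<^sub>R T (op_exp (\<lambda>w. t *\<^sub>R T w) v) \<bullet> b)) (at t)"
    unfolding c by (simp add: has_field_derivative_def mult_commute_abs)
qed

text \<open>Both terms of \<open>f\<close> solve \<open>w' = - T w\<close> and start at
  \<open>z\<close>, so they agree at time \<open>\<tau>\<close>, where the first equals
  \<open>v\<close>. Uniqueness thus replaces the multiplication of exponential series.\<close>

lemma op_exp_inverse:
  assumes "op_exp (\<lambda>w. \<tau> *\<^sub>R T w) v = z"
  shows "op_exp (\<lambda>w. (- \<tau>) *\<^sub>R T w) z = v"
proof -
  define f where "f s = op_exp (\<lambda>w. (\<tau> - s) *\<^sub>R T w) v - op_exp (\<lambda>w. (- s) *\<^sub>R T w) z" for s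
  have l: "linear (\<lambda>w. - T w)" using T by (simp add: linear_compose_neg)
  have nd: "((\<lambda>s. \<tau> - s) has_vector_derivative - 1) (at s)"
    and nd': "((\<lambda>s. - s) has_vector_derivative - 1) (at s)" for s :: real
    by (auto intro!: derivative_eq_intros)
  have 1: "((\<lambda>s. op_exp (\<lambda>w. (\<tau> - s) *\<^sub>R T w) v) has_vector_derivative - T (op_exp (\<lambda>w. (\<tau> - s) *\<^sub>R T w) v)) (at s)" for s
    using vector_diff_chain_at[OF nd op_exp_has_vector_derivative] by (simp add: o_def)
  have 2: "((\<lambda>s. op_exp (\<lambda>w. (- s) *\<^sub>R T w) z) has_vector_derivative - T (op_exp (\<lambda>w. (- s) *\<^sub>R T w) z)) (at s)" for s
    using vector_diff_chain_at[OF nd' op_exp_has_vector_derivative] by (simp add: o_def)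
  have "f \<tau> = 0"
  proof (rule linear_ode_unique[OF l])
    show "(f has_vector_derivative - T (f s)) (at s)" for s
      unfolding f_def using has_vector_derivative_diff[OF 1 2] by (simp add: linear_diff[OF T])
    show "f 0 = 0" using op_exp_0[of z] by (simp add: f_def assms)
  qed
  then show ?thesis using op_exp_0[of v] by (simp add: f_def)
qed

end

section \<open>Operators on a subspace\<close>

lemma det_on_eq_0_imp_kernel:
  fixes \<Omega> :: "'e::euclidean_space set"
  assumes \<Omega>: "subspace \<Omega>" and T: "operator_on \<Omega> T" and det: "det_on \<Omega> T = 0"
  shows "\<exists>z\<in>\<Omega>. z \<noteq> 0 \<and> T z = 0"
proof -
  \<comment> \<open>The same choice as in \<open>det_on\<close>. Nothing is known about it until
    some basis of \<open>\<Omega>\<close> has been exhibited.\<close>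
  define bs where "bs = (SOME bs. distinct bs \<and> independent (set bs) \<and> span (set bs) = \<Omega>)"
  define n where "n = length bs"
  define M where "M = Matrix.mat n n (\<lambda>(i, j). representation (set bs) (T (bs ! j)) (bs ! i))"
  obtain B' where B': "B' \<subseteq> \<Omega>" "independent B'" "\<Omega> \<subseteq> span B'"
    by (rule maximal_independent_subset)
  have sB': "span B' = \<Omega>" using B' \<Omega> span_minimal by blast
  obtain l where "set l = B'" "distinct l"
    using independent_imp_finite[OF B'(2)] finite_distinct_list by blast
  then have "\<exists>bs. distinct bs \<and> independent (set bs) \<and> span (set bs) = \<Omega>"
    using sB' B'(2) by blast
  then have bs: "distinct bs" "independent (set bs)" "span (set bs) = \<Omega>"
    unfolding bs_def by (metis (mono_tags, lifting) someI_ex)+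
  have T\<Omega>: "T v \<in> \<Omega>" if "v \<in> \<Omega>" for v using T that by (simp add: operator_on_def)
  have in\<Omega>: "bs ! j \<in> \<Omega>" if "j < n" for j
    using that bs(3) span_base[of "bs ! j" "set bs"] by (auto simp: n_def)
  have M: "M \<in> carrier_mat n n" by (simp add: M_def)
  have "Determinant.det M = 0"
    using det unfolding det_on_def Let_def M_def n_def bs_def .
  then obtain v where v: "v \<in> carrier_vec n" "v \<noteq> 0\<^sub>v n" "M *\<^sub>v v = 0\<^sub>v n"
    using det_0_iff_vec_prod_zero[OF M] by blast
  define z where "z = (\<Sum>j<n. vec_index v j *\<^sub>R bs ! j)"
  have sum_bs: "(\<Sum>b\<in>set bs. f b) = (\<Sum>j<n. f (bs ! j))" for f :: "'e \<Rightarrow> 'c::comm_monoid_add"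
    using sum.reindex_bij_betw[OF bij_betw_nth[OF bs(1), of "{..<n}" "set bs"], of f] by (simp add: n_def)
  have z\<Omega>: "z \<in> \<Omega>" unfolding z_def by (intro subspace_sum[OF \<Omega>] subspace_scale[OF \<Omega>] in\<Omega>) auto
  have "z \<noteq> 0"
  proof
    assume "z = 0"
    \<comment> \<open>Independence is stated for coefficients indexed by basis vectors, while
      \<open>v\<close> is indexed by positions; distinctness of \<open>bs\<close> makes the
      translation well defined.\<close>
    define f where "f b = vec_index v (THE j. j < n \<and> bs ! j = b)" for b
    have f: "f (bs ! j) = vec_index v j" if "j < n" for j
    proof -
      have "(THE i. i < n \<and> bs ! i = bs ! j) = j"
        using that bs(1) by (intro the_equality) (auto simp: n_def nth_eq_iff_index_eq)
      then show ?thesis by (simp add: f_def)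
    qed
    have "(\<Sum>b\<in>set bs. f b *\<^sub>R b) = 0"
      using \<open>z = 0\<close> unfolding sum_bs z_def by (simp add: f)
    then have "f b = 0" if "b \<in> set bs" for b
      using independentD[OF bs(2) finite_set order_refl _ that] by blast
    then have "vec_index v j = 0" if "j < n" for j using f[OF that] that by (simp add: n_def)
    then have "v = 0\<^sub>v n" using v(1) by (intro eq_vecI) auto
    then show False using v(2) by simp
  qed
  \<comment> \<open>\<open>T\<close> is additive on \<open>\<Omega>\<close> only, so the sum is
    split one summand at a time with every partial sum kept in \<open>\<Omega>\<close>.\<close>
  have Tsum: "T (\<Sum>j\<in>J. vec_index v j *\<^sub>R bs ! j) = (\<Sum>j\<in>J. vec_index v j *\<^sub>R T (bs ! j))"
    if "J \<subseteq> {..<n}" for J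
  proof -
    have "finite J" using that finite_subset by blast
    then show ?thesis using that
    proof (induction J rule: finite_induct)
      case empty
      \<comment> \<open>\<open>operator_on\<close> has no clause for zero; homogeneity with scalar 0
        supplies it.\<close>
      have "T (0 *\<^sub>R z) = 0 *\<^sub>R T z" using T z\<Omega> unfolding operator_on_def by blast
      then show ?case by simp
    next
      case (insert j J)
      have "bs ! j \<in> \<Omega>" "(\<Sum>j\<in>J. vec_index v j *\<^sub>R bs ! j) \<in> \<Omega>" "vec_index v j *\<^sub>R bs ! j \<in> \<Omega>"
        using insert.prems by (auto intro!: subspace_sum[OF \<Omega>] subspace_scale[OF \<Omega>] in\<Omega>)
      then show ?case using insert T unfolding operator_on_def by simp
    qed
  qed
  have Tspan: "T (bs ! j) \<in> span (set bs)" if "j < n" for j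
    using T\<Omega> in\<Omega>[OF that] bs(3) by simp
  have "representation (set bs) (T z) (bs ! i) = 0" if "i < n" for i
  proof -
    have "representation (set bs) (T z) (bs ! i) = (\<Sum>j<n. vec_index v j * representation (set bs) (T (bs ! j)) (bs ! i))"
      unfolding z_def Tsum[OF order_refl]
      by (subst representation_sum[OF bs(2)])
        (auto simp: representation_scale[OF bs(2)] Tspan intro!: span_scale)
    also have "\<dots> = vec_index (M *\<^sub>v v) i"
      using that v(1) by (simp add: M_def scalar_prod_def mult.commute lessThan_atLeast0)
    finally show ?thesis using v(3) that by simp
  qed
  then have 0: "representation (set bs) (T z) b = 0" if "b \<in> set bs" for b
    using that by (metis in_set_conv_nth n_def)
  have "(\<Sum>b\<in>set bs. representation (set bs) (T z) b *\<^sub>R b) = T z"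
    by (rule sum_representation_eq[OF bs(2)]) (use T\<Omega>[OF z\<Omega>] bs(3) in auto)
  then have "T z = 0" using 0 by simp
  then show ?thesis using z\<Omega> \<open>z \<noteq> 0\<close> by blast
qed

text \<open>Values of \<open>S\<close> off \<open>\<Omega>\<close> are arbitrary. A globally linear
  replacement is bounded and can therefore be differentiated along curves.\<close>

lemma operator_on_extend:
  fixes \<Omega> :: "'e::euclidean_space set"
  assumes \<Omega>: "subspace \<Omega>" and S: "operator_on \<Omega> S"
  obtains S' where "linear S'" "\<And>v. v \<in> \<Omega> \<Longrightarrow> S' v = S v"
proof -
  obtain B' where B': "B' \<subseteq> \<Omega>" "independent B'" "\<Omega> \<subseteq> span B'"
    by (rule maximal_independent_subset)
  have "\<exists>S'. linear S' \<and> (\<forall>v\<in>B'. S' v = S v)"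
    by (rule linear_independent_extend[OF B'(2)])
  then obtain S' where S': "linear S'" "\<And>v. v \<in> B' \<Longrightarrow> S' v = S v"
    by metis
  have *: "v \<in> \<Omega> \<and> S' v = S v" if "v \<in> span B'" for v
    using that
  proof (induction rule: span_induct_alt)
    case base
    have "S (0 *\<^sub>R 0) = 0 *\<^sub>R S 0" using S subspace_0[OF \<Omega>] unfolding operator_on_def by blast
    then show ?case using subspace_0[OF \<Omega>] by (simp add: linear_0[OF S'(1)])
  next
    case (step r x y)
    have "x \<in> \<Omega>" "r *\<^sub>R x \<in> \<Omega>" using step B'(1) subspace_scale[OF \<Omega>] by auto
    then show ?case
      using step S subspace_add[OF \<Omega>] S'(2)
      by (simp add: operator_on_def linear_add[OF S'(1)] linear_scale[OF S'(1)])
  qed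
  show thesis
    by (rule that[OF S'(1)]) (use * B'(3) in auto)
qed

text \<open>Variation of constants for \<open>y' + A y = p\<close>, \<open>p' = F p\<close>: the
  Sylvester identity evaluates the integral in closed form, and a kernel vector of the given
  operator makes the endpoint vanish.\<close>

lemma sylvester_solution:
  fixes \<Omega> :: "'e::euclidean_space set"
  assumes A: "linear A" and F: "linear F"
    and \<Omega>: "subspace \<Omega>" "A ` \<Omega> \<subseteq> \<Omega>" "F ` \<Omega> \<subseteq> \<Omega>"
    and S: "operator_on \<Omega> S" "\<And>v. v \<in> \<Omega> \<Longrightarrow> S (F v) + A (S v) = v"
    and det: "det_on \<Omega> (\<lambda>v. op_exp (\<lambda>w. \<tau> *\<^sub>R A w) (S (op_exp (\<lambda>w. \<tau> *\<^sub>R F w) v)) - S v) = 0"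
  obtains y y' y'' where "smooth_on y UNIV"
    "\<And>t. (y has_vector_derivative y' t) (at t)" "\<And>t. (y' has_vector_derivative y'' t) (at t)"
    "\<And>t. y'' t + A (y' t) = F (y' t + A (y t))" "y 0 = 0" "y \<tau> = 0" "\<exists>t. y t \<noteq> 0"
proof -
  define eA where "eA t = op_exp (\<lambda>w. t *\<^sub>R A w)" for t
  define eF where "eF t = op_exp (\<lambda>w. t *\<^sub>R F w)" for t
  have eA\<Omega>: "eA t v \<in> \<Omega>" and eF\<Omega>: "eF t v \<in> \<Omega>" if "v \<in> \<Omega>" for t v
    using op_exp_in_subspace[OF A \<Omega>(1,2) that] op_exp_in_subspace[OF F \<Omega>(1,3) that] by (auto simp: eA_def eF_def)
  have exp_linear: "op_exp (\<lambda>w. t *\<^sub>R T w) (v + w) = op_exp (\<lambda>w. t *\<^sub>R T w) v + op_exp (\<lambda>w. t *\<^sub>R T w) w"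
    "op_exp (\<lambda>w. t *\<^sub>R T w) (r *\<^sub>R v) = r *\<^sub>R op_exp (\<lambda>w. t *\<^sub>R T w) v"
    if T: "linear T" for T :: "'e \<Rightarrow> 'e" and t v w r
  proof -
    have p: "(T ^^ n) (v + w) = (T ^^ n) v + (T ^^ n) w" "(T ^^ n) (r *\<^sub>R v) = r *\<^sub>R (T ^^ n) v" for n
      by (induction n) (auto simp: linear_add[OF T] linear_scale[OF T])
    show "op_exp (\<lambda>w. t *\<^sub>R T w) (v + w) = op_exp (\<lambda>w. t *\<^sub>R T w) v + op_exp (\<lambda>w. t *\<^sub>R T w) w"
      unfolding op_exp_scaleR[OF T] by (simp only: suminf_add[OF summable_op_exp[OF T] summable_op_exp[OF T]] p scaleR_add_right)
    show "op_exp (\<lambda>w. t *\<^sub>R T w) (r *\<^sub>R v) = r *\<^sub>R op_exp (\<lambda>w. t *\<^sub>R T w) v"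
      unfolding op_exp_scaleR[OF T] by (subst suminf_scaleR_right[OF summable_op_exp[OF T]]) (simp add: p mult_ac)
  qed
  \<comment> \<open>Linearity on \<open>\<Omega>\<close> is what allows the vanishing determinant to
    be turned into a kernel vector.\<close>
  have "operator_on \<Omega> (\<lambda>v. eA \<tau> (S (eF \<tau> v)) - S v)"
    unfolding operator_on_def
  proof (intro conjI ballI allI)
    fix v w r assume v: "v \<in> \<Omega>"
    have S\<Omega>: "S v \<in> \<Omega>" if "v \<in> \<Omega>" for v using S(1) that by (simp add: operator_on_def)
    have Sl: "S (v + w) = S v + S w" "S (r *\<^sub>R v) = r *\<^sub>R S v" if "v \<in> \<Omega>" "w \<in> \<Omega>" for v w r
      using S(1) that by (auto simp: operator_on_def)
    show "eA \<tau> (S (eF \<tau> v)) - S v \<in> \<Omega>"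
      using v by (intro subspace_diff[OF \<Omega>(1)] eA\<Omega> S\<Omega> eF\<Omega>)
    show "eA \<tau> (S (eF \<tau> (r *\<^sub>R v))) - S (r *\<^sub>R v) = r *\<^sub>R (eA \<tau> (S (eF \<tau> v)) - S v)"
      using exp_linear(2)[OF F] exp_linear(2)[OF A] Sl(2)[OF eF\<Omega>[OF v] v] Sl(2)[OF v v]
      by (simp add: eA_def eF_def scaleR_diff_right)
    assume w: "w \<in> \<Omega>"
    show "eA \<tau> (S (eF \<tau> (v + w))) - S (v + w) = eA \<tau> (S (eF \<tau> v)) - S v + (eA \<tau> (S (eF \<tau> w)) - S w)"
      using exp_linear(1)[OF F] exp_linear(1)[OF A] Sl(1)[OF eF\<Omega>[OF v] eF\<Omega>[OF w]] Sl(1)[OF v w]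
      by (simp add: eA_def eF_def)
  qed
  then obtain z where z: "z \<in> \<Omega>" "z \<noteq> 0" "eA \<tau> (S (eF \<tau> z)) = S z"
    using det_on_eq_0_imp_kernel[OF \<Omega>(1) _ det] unfolding eA_def eF_def by auto
  obtain S' where S': "linear S'" "\<And>v. v \<in> \<Omega> \<Longrightarrow> S' v = S v"
    using operator_on_extend[OF \<Omega>(1) S(1)] by metis
  define p where "p t = eF t z" for t
  define q where "q t = eA (- t) (S z)" for t
  have p\<Omega>: "p t \<in> \<Omega>" "F (p t) \<in> \<Omega>" for t
    using eF\<Omega>[OF z(1)] \<Omega>(3) by (auto simp: p_def)
  have dp: "(p has_vector_derivative F (p t)) (at t)" for t
    unfolding p_def eF_def by (rule op_exp_has_vector_derivative[OF F])
  have nd: "((\<lambda>s. - s) has_vector_derivative - 1) (at s)" for s :: real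
    by (auto intro!: derivative_eq_intros)
  have dq: "(q has_vector_derivative - A (q t)) (at t)" for t
    unfolding q_def eA_def
    using vector_diff_chain_at[OF nd op_exp_has_vector_derivative[OF A]] by (simp add: o_def)
  have lA: "linear (\<lambda>w. - A w)" using A by (simp add: linear_compose_neg)
  have bS: "bounded_linear S'" "bounded_linear A" "bounded_linear F"
    using S' A F by (auto simp: linear_conv_bounded_linear)
  note lin [simp] = linear_add[OF A] linear_diff[OF A] linear_neg[OF A] linear_add[OF F] linear_diff[OF F]
  \<comment> \<open>\<open>S' (p t)\<close> is a particular solution of \<open>y' + A y = p\<close>,
    and \<open>q\<close> is the solution of the homogeneous equation that cancels it at time 0. At
    \<open>\<tau>\<close> the two cancel again exactly when
    \<open>eA \<tau> (S (eF \<tau> z)) = S z\<close>.\<close>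
  define y where "y t = S' (p t) - q t" for t
  define y' where "y' t = S' (F (p t)) + A (q t)" for t
  define y'' where "y'' t = S' (F (F (p t))) - A (A (q t))" for t
  have syl: "S' (F v) + A (S' v) = v" if "v \<in> \<Omega>" for v
    using S(2)[OF that] S'(2) that \<Omega>(3) by auto
  have y1: "y' t + A (y t) = p t" for t
    using syl[OF p\<Omega>(1)] by (simp add: y_def y'_def)
  have "smooth_on y UNIV"
    unfolding y_def diff_conv_add_uminus
    by (intro smooth_on_add smooth_on_bounded_linear[OF bS(1)] open_UNIV linear_ode_smooth[OF F dp]
       smooth_on_bounded_linear[OF bounded_linear_minus[OF bounded_linear_ident]] linear_ode_smooth[OF lA dq])
  moreover have "(y has_vector_derivative y' t) (at t)" for t
    using has_vector_derivative_diff[OF bounded_linear.has_vector_derivative[OF bS(1) dp] dq]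
    unfolding y_def y'_def by simp
  moreover have "(y' has_vector_derivative y'' t) (at t)" for t
    using has_vector_derivative_add[OF
        bounded_linear.has_vector_derivative[OF bS(1) bounded_linear.has_vector_derivative[OF bS(3) dp]]
        bounded_linear.has_vector_derivative[OF bS(2) dq]]
    unfolding y'_def y''_def by simp
  moreover have "y'' t + A (y' t) = F (y' t + A (y t))" for t
    using syl[OF p\<Omega>(2)] unfolding y1 by (simp add: y'_def y''_def)
  moreover have "y 0 = 0"
    using op_exp_0[OF F, of z] op_exp_0[OF A, of "S z"] S'(2)[OF z(1)]
    by (simp add: y_def p_def q_def eA_def eF_def)
  moreover have "y \<tau> = 0"
    using op_exp_inverse[OF A, of \<tau> "S (eF \<tau> z)" "S z"] z(3) S'(2)[OF eF\<Omega>[OF z(1)]]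
    by (simp add: y_def p_def q_def eA_def)
  \<comment> \<open>If \<open>y\<close> vanished identically, \<open>y' + A y = p\<close> at time 0
    would give \<open>z = 0\<close>.\<close>
  moreover have "\<exists>t. y t \<noteq> 0"
  proof (rule ccontr)
    assume *: "\<nexists>t. y t \<noteq> 0"
    then have "y = (\<lambda>t. 0)" by auto
    then have "y' 0 = 0"
      using \<open>(y has_vector_derivative y' 0) (at 0)\<close> vector_derivative_unique_at[of y "y' 0" 0 0] by simp
    then have "p 0 = 0" using y1[of 0] * linear_0[OF A] by simp
    then show False using z(2) op_exp_0[OF F, of z] by (simp add: p_def eF_def)
  qed
  ultimately show thesis using that by blast
qed

section \<open>Inner products on a Euclidean space\<close>

locale inner_form =
  fixes ip :: "'e::euclidean_space \<Rightarrow> 'e \<Rightarrow> real"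
  assumes bil: "bilinear ip"
    and sym: "ip v w = ip w v"
    and pos: "v \<noteq> 0 \<Longrightarrow> ip v v > 0"
begin

lemma linear_left: "linear (\<lambda>v. ip v w)" and linear_right: "linear (ip v)"
  using bil by (auto simp: bilinear_def)

lemmas ip_simps = linear_add[OF linear_left] linear_add[OF linear_right]
  linear_diff[OF linear_left] linear_diff[OF linear_right]
  linear_neg[OF linear_left] linear_neg[OF linear_right]
  linear_scale[OF linear_left] linear_scale[OF linear_right]
  linear_0[OF linear_left] linear_0[OF linear_right]

lemma ip_eqI: "(\<And>w. ip z w = ip z' w) \<Longrightarrow> z = z'"
  using pos[of "z - z'"] by (auto simp: ip_simps)

text \<open>The Gram operator of \<open>ip\<close> with respect to the Euclidean structure; its
  inverse recovers a vector from its pairings with \<open>Basis\<close>.\<close>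

definition coords :: "'e \<Rightarrow> 'e" where
  "coords z = (\<Sum>b\<in>Basis. ip z b *\<^sub>R b)"

definition coords_inv :: "'e \<Rightarrow> 'e" where
  "coords_inv = inv_into UNIV coords"

lemma linear_coords: "linear coords"
  unfolding coords_def
  by (intro linearI) (simp_all add: ip_simps sum.distrib scaleR_left_distrib scaleR_sum_right)

lemma coords_inner: "b \<in> Basis \<Longrightarrow> coords z \<bullet> b = ip z b"
  unfolding coords_def by simp

lemma inj_coords: "inj coords"
  unfolding linear_injective_0[OF linear_coords]
proof (intro allI impI)
  fix z assume "coords z = 0"
  then have "ip z b = 0" if "b \<in> Basis" for b using coords_inner[OF that, of z] by simp
  then have "ip z w = 0" for w
    using linear_sum[OF linear_right, of z "\<lambda>b. (w \<bullet> b) *\<^sub>R b" Basis]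
    by (simp add: euclidean_representation ip_simps)
  then show "z = 0" using pos[of z] by fastforce
qed

lemma bij_coords: "bij coords"
  using inj_coords linear_injective_imp_surjective[OF linear_coords] by (simp add: bij_def)

lemma coords_inv_left [simp]: "coords_inv (coords z) = z"
  and coords_inv_right [simp]: "coords (coords_inv z) = z"
  using bij_coords by (auto simp: coords_inv_def bij_is_inj bij_is_surj surj_f_inv_f)

lemma linear_coords_inv: "linear coords_inv"
  by (rule linearI; rule injD[OF inj_coords])
    (simp_all add: linear_add[OF linear_coords] linear_scale[OF linear_coords])

lemma riesz_eqI: "(\<And>w. ip z w = l w) \<Longrightarrow> riesz ip l = z"
  unfolding riesz_def by (rule the_equality) (auto intro: ip_eqI)

text \<open>\<open>riesz\<close> is a definite description, so a representing vector must first be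
  produced: the inverse Gram operator applied to the values of \<open>l\<close> on
  \<open>Basis\<close>.\<close>

lemma ip_riesz:
  assumes "linear l"
  shows "ip (riesz ip l) w = l w"
proof -
  define z where "z = coords_inv (\<Sum>b\<in>Basis. l b *\<^sub>R b)"
  have "ip z b = l b" if "b \<in> Basis" for b
    using coords_inner[OF that, of z] that by (simp add: z_def)
  then have "ip z w = l w" for w
    using linear_sum[OF linear_right, of z "\<lambda>b. (w \<bullet> b) *\<^sub>R b" Basis]
      linear_sum[OF assms, of "\<lambda>b. (w \<bullet> b) *\<^sub>R b" Basis]
    by (simp add: euclidean_representation ip_simps linear_scale[OF assms])
  then show ?thesis using riesz_eqI by metis
qed

end

section \<open>The Levi-Civita connection in an invariant frame\<close>

text \<open>The local picture in one chart: \<open>U\<close> is the image of the chart,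
  \<open>G\<close> its metric, and \<open>E x\<close> identifies the Lie algebra with the tangent
  space at \<open>x\<close>. A point of \<open>U\<close> is needed to read off identities of the
  constant bracket \<open>br\<close> from those of vector fields.\<close>

locale frame =
  fixes U :: "'e::euclidean_space set" and G :: "'e \<Rightarrow> 'e \<Rightarrow> 'e \<Rightarrow> real" and E :: "'e \<Rightarrow> 'e \<Rightarrow> 'e"
    and ip :: "'e \<Rightarrow> 'e \<Rightarrow> real" and br :: "'e \<Rightarrow> 'e \<Rightarrow> 'e"
  assumes open_U: "open U"
    and metric: "x \<in> U \<Longrightarrow> inner_form (G x)"
    and metric_smooth: "smooth_on (\<lambda>x. G x v w) U"
    and ip: "inner_form ip"
    and E_linear: "x \<in> U \<Longrightarrow> linear (E x)"
    and E_smooth: "smooth_on (\<lambda>x. E x v) U"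
    and isometry: "x \<in> U \<Longrightarrow> G x (E x v) (E x w) = ip v w"
    and br_bilinear: "bilinear br"
    and bracket: "x \<in> U \<Longrightarrow> field_bracket (\<lambda>x. E x v) (\<lambda>x. E x w) x = E x (br v w)"
    and U_nonempty: "U \<noteq> {}"
begin

sublocale ip: inner_form ip by (rule ip)

lemma bij_E:
  assumes "x \<in> U"
  shows "bij (E x)"
proof -
  have "inj (E x)"
    unfolding linear_injective_0[OF E_linear[OF assms]]
  proof (intro allI impI)
    fix v assume "E x v = 0"
    then have "ip v v = 0"
      using isometry[OF assms, of v v] inner_form.ip_simps[OF metric[OF assms]] by simp
    then show "v = 0" using ip.pos[of v] by fastforce
  qed
  then show ?thesis
    using linear_injective_imp_surjective[OF E_linear[OF assms]] by (simp add: bij_def)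
qed

lemma E_cases:
  assumes "x \<in> U"
  obtains v where "z = E x v"
  using bij_is_surj[OF bij_E[OF assms]] by (metis surjD)

lemma E_eq_iff: "x \<in> U \<Longrightarrow> E x v = E x w \<longleftrightarrow> v = w"
  using bij_E by (meson bij_is_inj inj_eq)

lemma metric_eqI:
  assumes "x \<in> U" "\<And>v. G x z (E x v) = G x z' (E x v)"
  shows "z = z'"
  using inner_form.ip_eqI[OF metric[OF assms(1)]] assms E_cases[OF assms(1)] by metis

text \<open>Inversion through the metric: by \<open>isometry\<close>, pairing with
  \<open>E x b\<close> in \<open>G x\<close> gives the \<open>ip\<close>-pairings of the preimage
  with \<open>b\<close>. The only inverse operator, \<open>ip.coords_inv\<close>, is constant in
  \<open>x\<close>, so smoothness in \<open>x\<close> is visible.\<close>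

definition E_inv :: "'e \<Rightarrow> 'e \<Rightarrow> 'e" where
  "E_inv x z = ip.coords_inv (\<Sum>b\<in>Basis. G x z (E x b) *\<^sub>R b)"

lemma E_inv_E [simp]:
  assumes "x \<in> U"
  shows "E_inv x (E x v) = v"
proof -
  have "(\<Sum>b\<in>Basis. G x (E x v) (E x b) *\<^sub>R b) = ip.coords v"
    by (simp add: ip.coords_def isometry[OF assms])
  then show ?thesis by (simp add: E_inv_def)
qed

lemma E_E_inv [simp]: "x \<in> U \<Longrightarrow> E x (E_inv x z) = z"
  using E_cases E_inv_E by metis

lemma metric_linear:
  assumes "x \<in> U"
  shows "linear (\<lambda>v. G x v w)" "linear (G x w)"
  using inner_form.linear_left[OF metric[OF assms]] inner_form.linear_right[OF metric[OF assms]] by auto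

definition DE :: "'e \<Rightarrow> 'e \<Rightarrow> 'e \<Rightarrow> 'e" where
  "DE x v h = frechet_derivative (\<lambda>x. E x v) (at x) h"

definition DG :: "'e \<Rightarrow> 'e \<Rightarrow> 'e \<Rightarrow> 'e \<Rightarrow> real" where
  "DG x v w h = frechet_derivative (\<lambda>x. G x v w) (at x) h"

lemma has_derivative_E: "x \<in> U \<Longrightarrow> ((\<lambda>x. E x v) has_derivative DE x v) (at x)"
  unfolding DE_def using smooth_on_has_derivative[OF E_smooth] .

lemma has_derivative_G: "x \<in> U \<Longrightarrow> ((\<lambda>x. G x v w) has_derivative DG x v w) (at x)"
  unfolding DG_def using smooth_on_has_derivative[OF metric_smooth] .

lemma DG_linear:
  assumes "x \<in> U"
  shows "linear (DG x v w)" "linear (\<lambda>w. DG x v w h)" "linear (\<lambda>v. DG x v w h)"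
proof -
  show "linear (DG x v w)"
    using has_derivative_G[OF assms] has_derivative_linear by blast
  show "linear (\<lambda>w. DG x v w h)"
    by (rule linear_derivative_family[OF open_U assms metric_linear(2) has_derivative_G[OF assms]])
  show "linear (\<lambda>v. DG x v w h)"
    by (rule linear_derivative_family[OF open_U assms metric_linear(1) has_derivative_G[OF assms]])
qed

lemma DE_linear: "x \<in> U \<Longrightarrow> linear (DE x v)"
  using has_derivative_E has_derivative_linear by blast

lemma bracket_DE: "x \<in> U \<Longrightarrow> DE x w (E x v) - DE x v (E x w) = E x (br v w)"
  using bracket[of x v w] by (simp add: field_bracket_def DE_def)

lemma br_antisym: "br w v = - br v w"
proof -
  obtain x where x: "x \<in> U" using U_nonempty by blast
  have "E x (br w v) = E x (- br v w)"
    unfolding linear_neg[OF E_linear[OF x]] bracket_DE[OF x, symmetric] by simp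
  then show ?thesis using E_eq_iff[OF x] by simp
qed

lemma br_linear: "linear (br v)" "linear (\<lambda>v. br v w)"
  using br_bilinear by (auto simp: bilinear_def)

text \<open>The metric coefficients in the frame are constant, so their derivative vanishes. This
  trades derivatives of the metric for derivatives of the frame.\<close>

lemma isometry_derivative:
  assumes x: "x \<in> U"
  shows "DG x (E x v) (E x w) h = - G x (DE x v h) (E x w) - G x (E x v) (DE x w h)"
proof -
  have 1: "((\<lambda>y. G y a (E y w)) has_derivative (\<lambda>h. DG x a (E x w) h + G x a (DE x w h))) (at x)" for a
    by (rule has_derivative_linear_family[OF open_U x metric_linear(2) has_derivative_G[OF x] has_derivative_E[OF x]])
  have "((\<lambda>y. G y (E y v) (E y w)) has_derivative
     (\<lambda>h. DG x (E x v) (E x w) h + G x (E x v) (DE x w h) + G x (DE x v h) (E x w))) (at x)"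
    by (rule has_derivative_linear_family[OF open_U x metric_linear(1) 1 has_derivative_E[OF x]])
  moreover have "((\<lambda>y. G y (E y v) (E y w)) has_derivative (\<lambda>h. 0)) (at x)"
    by (rule has_derivative_transform_within_open[OF has_derivative_const open_U x]) (simp add: isometry)
  ultimately have "(\<lambda>h. DG x (E x v) (E x w) h + G x (E x v) (DE x w h) + G x (DE x v h) (E x w)) = (\<lambda>h. 0)"
    by (rule has_derivative_unique)
  from fun_cong[OF this, of h] show ?thesis by simp
qed

abbreviation \<Gamma> :: "'e \<Rightarrow> 'e \<Rightarrow> 'e \<Rightarrow> 'e" where
  "\<Gamma> \<equiv> christoffel G"

text \<open>The Christoffel symbols of the first kind, that is, the functional in \<open>y\<close>
  represented by \<open>\<Gamma> x v w\<close>.\<close>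

definition koszul :: "'e \<Rightarrow> 'e \<Rightarrow> 'e \<Rightarrow> 'e \<Rightarrow> real" where
  "koszul x v w y = (DG x w y v + DG x v y w - DG x v w y) / 2"

lemma linear_koszul:
  assumes "x \<in> U"
  shows "linear (koszul x v w)" "linear (\<lambda>v. koszul x v w y)" "linear (\<lambda>w. koszul x v w y)"
  unfolding koszul_def using DG_linear[OF assms]
  by (auto intro!: linearI simp: linear_add[OF DG_linear(1)[OF assms]] linear_scale[OF DG_linear(1)[OF assms]]
      linear_add[OF DG_linear(2)[OF assms]] linear_scale[OF DG_linear(2)[OF assms]]
      linear_add[OF DG_linear(3)[OF assms]] linear_scale[OF DG_linear(3)[OF assms]] field_simps)

lemma metric_christoffel:
  assumes "x \<in> U"
  shows "G x (\<Gamma> x v w) y = koszul x v w y"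
  using inner_form.ip_riesz[OF metric[OF assms] linear_koszul(1)[OF assms]]
  unfolding christoffel_def koszul_def DG_def .

lemma christoffel_linear:
  assumes x: "x \<in> U"
  shows "linear (\<Gamma> x v)" "linear (\<lambda>v. \<Gamma> x v w)"
  by (auto intro!: linearI inner_form.ip_eqI[OF metric[OF x]]
      simp: metric_christoffel[OF x] inner_form.ip_simps[OF metric[OF x]]
        linear_add[OF linear_koszul(2)[OF x]] linear_add[OF linear_koszul(3)[OF x]]
        linear_scale[OF linear_koszul(2)[OF x]] linear_scale[OF linear_koszul(3)[OF x]])

text \<open>The definite description inside \<open>christoffel\<close> hides its dependence on
  \<open>x\<close>. Passing through \<open>E_inv\<close> and back replaces it by an explicit
  expression in the metric, its derivatives and the frame.\<close>

lemma smooth_on_christoffel: "smooth_on (\<lambda>x. \<Gamma> x v w) U"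
proof (rule smooth_on_cong[OF open_U])
  have "smooth_on (\<lambda>x. DG x a b h) U" for a b h
    unfolding DG_def by (rule smooth_on_frechet_derivative[OF metric_smooth])
  then have "smooth_on (\<lambda>x. koszul x v w y) U" for y
    unfolding koszul_def
    by (intro smooth_on_bounded_linear[OF bounded_linear_divide open_U] smooth_on_diff[OF open_U]
        smooth_on_add[OF open_U])
  then have "smooth_on (\<lambda>x. koszul x v w (E x b)) U" for b
    using linear_koszul(1)
    by (intro smooth_on_linear_family[where T = "\<lambda>x. koszul x v w" and f = "\<lambda>x. E x b", OF open_U _ _ E_smooth])
  then have *: "smooth_on (\<lambda>x. \<Sum>b\<in>Basis. koszul x v w (E x b) *\<^sub>R b) U"
    by (intro smooth_on_sum[OF open_U finite_Basis] smooth_on_bounded_linear[OF bounded_linear_scaleR_left open_U])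
  have **: "smooth_on (\<lambda>x. ip.coords_inv (\<Sum>b\<in>Basis. koszul x v w (E x b) *\<^sub>R b)) U"
    by (rule smooth_on_bounded_linear[OF _ open_U *]) (use ip.linear_coords_inv in \<open>simp add: linear_conv_bounded_linear\<close>)
  show "smooth_on (\<lambda>x. E x (ip.coords_inv (\<Sum>b\<in>Basis. koszul x v w (E x b) *\<^sub>R b))) U"
    by (rule smooth_on_linear_family[where T = E, OF open_U E_linear E_smooth **])
  fix x assume x: "x \<in> U"
  have "E x (E_inv x (\<Gamma> x v w)) = \<Gamma> x v w" using x by simp
  then show "E x (ip.coords_inv (\<Sum>b\<in>Basis. koszul x v w (E x b) *\<^sub>R b)) = \<Gamma> x v w"
    by (simp add: E_inv_def metric_christoffel[OF x])
qed

definition adj :: "'e \<Rightarrow> 'e \<Rightarrow> 'e" where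
  "adj u v = riesz ip (\<lambda>w. ip v (br u w))"

lemma ip_adj: "ip (adj u v) w = ip v (br u w)"
  unfolding adj_def
  by (rule ip.ip_riesz) (use linear_compose[OF br_linear(1) ip.linear_right] in \<open>simp add: o_def\<close>)

lemma adj_linear: "linear (adj u)" "linear (\<lambda>u. adj u v)"
  by (auto intro!: linearI ip.ip_eqI simp: ip_adj ip.ip_simps linear_add[OF br_linear(2)] linear_scale[OF br_linear(2)])

text \<open>The Levi-Civita connection on left-invariant fields, as given by Koszul's formula when
  all metric coefficients are constant.\<close>

definition B :: "'e \<Rightarrow> 'e \<Rightarrow> 'e" where
  "B v w = (br v w - adj v w - adj w v) /\<^sub>R 2"

lemma B_linear: "linear (B v)" "linear (\<lambda>v. B v w)"
  unfolding B_def
  by (auto intro!: linearI simp: linear_add[OF br_linear(1)] linear_add[OF br_linear(2)]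
      linear_add[OF adj_linear(1)] linear_add[OF adj_linear(2)]
      linear_scale[OF br_linear(1)] linear_scale[OF br_linear(2)]
      linear_scale[OF adj_linear(1)] linear_scale[OF adj_linear(2)] algebra_simps)

lemma B_torsion: "B v w - B w v = br v w"
  unfolding B_def by (simp add: br_antisym[of w v] algebra_simps flip: scaleR_left.add)

lemma B_self: "B u u = - adj u u"
proof -
  have "2 *\<^sub>R br u u = 0"
    unfolding scaleR_2 by (subst br_antisym) simp
  then have "B u u = (1 / 2) *\<^sub>R (- adj u u + - adj u u)"
    by (simp add: B_def)
  then show ?thesis by (simp only: scaleR_half_double)
qed

text \<open>The left side is the covariant derivative of one frame field along another. Paired with
  a third frame field, its metric derivatives become frame derivatives, whose antisymmetric
  combinations are brackets.\<close>

lemma covariant_frame: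
  assumes x: "x \<in> U"
  shows "\<Gamma> x (E x v) (E x w) + DE x w (E x v) = E x (B v w)"
proof (rule metric_eqI[OF x])
  fix y
  interpret Gx: inner_form "G x" by (rule metric[OF x])
  note [simp] = Gx.ip_simps
  have i: "G x (E x a) (DE x c (E x b)) - G x (E x a) (DE x b (E x c)) = ip a (br b c)" for a b c
    using arg_cong[OF bracket_DE[OF x, of c b], of "G x (E x a)"] by (simp add: isometry[OF x])
  note s = Gx.sym[of "DE x _ _"]
  have "2 * G x (\<Gamma> x (E x v) (E x w)) (E x y) = ip (br v w) y - ip w (br v y) - ip v (br w y)
      - 2 * G x (DE x w (E x v)) (E x y)"
    \<comment> \<open>One instance for each of the three brackets in Koszul's formula.\<close>
    using i[of y v w] i[of w v y] i[of v w y]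
    by (simp add: metric_christoffel[OF x] koszul_def isometry_derivative[OF x] s ip.sym[of "br _ _"]
        br_antisym[of y] br_antisym[of w v] ip.ip_simps)
  moreover have "2 * ip (B v w) y = ip (br v w) y - ip w (br v y) - ip v (br w y)"
    by (simp add: B_def ip.ip_simps ip_adj)
  ultimately show "G x (\<Gamma> x (E x v) (E x w) + DE x w (E x v)) (E x y) = G x (E x (B v w)) (E x y)"
    by (simp add: isometry[OF x])
qed

section \<open>Curvature and the Jacobi equation in the frame\<close>

definition D\<Gamma> :: "'e \<Rightarrow> 'e \<Rightarrow> 'e \<Rightarrow> 'e \<Rightarrow> 'e" where
  "D\<Gamma> x v w h = frechet_derivative (\<lambda>x. \<Gamma> x v w) (at x) h"

definition DDE :: "'e \<Rightarrow> 'e \<Rightarrow> 'e \<Rightarrow> 'e \<Rightarrow> 'e" where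
  "DDE x w a h = frechet_derivative (\<lambda>x. DE x w a) (at x) h"

lemma has_derivative_christoffel: "x \<in> U \<Longrightarrow> ((\<lambda>x. \<Gamma> x v w) has_derivative D\<Gamma> x v w) (at x)"
  unfolding D\<Gamma>_def using smooth_on_has_derivative[OF smooth_on_christoffel] .

lemma has_derivative_DE: "x \<in> U \<Longrightarrow> ((\<lambda>x. DE x w a) has_derivative DDE x w a) (at x)"
  unfolding DDE_def using smooth_on_has_derivative[OF smooth_on_frechet_derivative[OF E_smooth]]
  by (simp add: DE_def)

lemma DDE_sym: "x \<in> U \<Longrightarrow> DDE x w a h = DDE x w h a"
  unfolding DDE_def DE_def by (rule symmetric_second_derivative[OF open_U _ E_smooth])

text \<open>\<open>curvature\<close> differentiates \<open>\<Gamma>\<close> at frozen arguments.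
  Differentiating \<open>covariant_frame\<close>, where the arguments move, isolates that derivative
  among frame terms.\<close>

lemma christoffel_derivative:
  assumes x: "x \<in> U"
  shows "D\<Gamma> x (E x v) (E x w) h + \<Gamma> x (E x v) (DE x w h) + \<Gamma> x (DE x v h) (E x w)
    = DE x (B v w) h - DDE x w (E x v) h - DE x w (DE x v h)"
proof -
  have 1: "((\<lambda>y. \<Gamma> y a (E y w)) has_derivative (\<lambda>h. D\<Gamma> x a (E x w) h + \<Gamma> x a (DE x w h))) (at x)" for a
    by (rule has_derivative_linear_family[where T = "\<lambda>y. \<Gamma> y a", OF open_U x christoffel_linear(1)
          has_derivative_christoffel[OF x] has_derivative_E[OF x]])
  have l: "((\<lambda>y. \<Gamma> y (E y v) (E y w)) has_derivative
     (\<lambda>h. D\<Gamma> x (E x v) (E x w) h + \<Gamma> x (E x v) (DE x w h) + \<Gamma> x (DE x v h) (E x w))) (at x)"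
    by (rule has_derivative_linear_family[where T = "\<lambda>y a. \<Gamma> y a (E y w)", OF open_U x
          christoffel_linear(2) 1 has_derivative_E[OF x]])
  have 2: "((\<lambda>y. DE y w (E y v)) has_derivative (\<lambda>h. DDE x w (E x v) h + DE x w (DE x v h))) (at x)"
    by (rule has_derivative_linear_family[where T = "\<lambda>y. DE y w", OF open_U x DE_linear
          has_derivative_DE[OF x] has_derivative_E[OF x]])
  have "((\<lambda>y. \<Gamma> y (E y v) (E y w)) has_derivative
     (\<lambda>h. DE x (B v w) h - (DDE x w (E x v) h + DE x w (DE x v h)))) (at x)"
    by (rule has_derivative_transform_within_open[OF has_derivative_diff[OF has_derivative_E[OF x] 2] open_U x])
      (simp flip: covariant_frame)
  from fun_cong[OF has_derivative_unique[OF l this], of h] show ?thesis by (simp add: algebra_simps)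
qed

lemma curvature_frame:
  assumes x: "x \<in> U"
  shows "curvature G x (E x u) (E x v) (E x w) = E x (B u (B v w) - B v (B u w) - B (br u v) w)"
proof -
  note [simp] = linear_add[OF E_linear[OF x]] linear_diff[OF E_linear[OF x]]
    linear_diff[OF christoffel_linear(1)[OF x]] linear_diff[OF christoffel_linear(2)[OF x]]
    linear_diff[OF DE_linear[OF x]]
  have c: "\<Gamma> x (E x a) (E x b) = E x (B a b) - DE x b (E x a)" for a b
    using covariant_frame[OF x, of a b] by (simp add: algebra_simps)
  have r: "E x (br u v) = DE x v (E x u) - DE x u (E x v)"
    using bracket_DE[OF x] by simp
  have 1: "\<Gamma> x (E x (br u v)) (E x w) = \<Gamma> x (DE x v (E x u)) (E x w) - \<Gamma> x (DE x u (E x v)) (E x w)"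
    by (simp add: r)
  have 2: "\<Gamma> x (E x a) (\<Gamma> x (E x b) (E x w)) = E x (B a (B b w)) - DE x (B b w) (E x a)
      - \<Gamma> x (E x a) (DE x w (E x b))" for a b
    by (simp add: c)
  have 3: "DE x w (E x (br u v)) = DE x w (DE x v (E x u)) - DE x w (DE x u (E x v))"
    by (simp add: r)
  have d: "D\<Gamma> x (E x a) (E x b) h = DE x (B a b) h - DDE x b (E x a) h - DE x b (DE x a h)
      - \<Gamma> x (E x a) (DE x b h) - \<Gamma> x (DE x a h) (E x b)" for a b h
    unfolding christoffel_derivative[OF x, symmetric] by simp
  have "curvature G x (E x u) (E x v) (E x w)
    = D\<Gamma> x (E x v) (E x w) (E x u) - D\<Gamma> x (E x u) (E x w) (E x v)
     + \<Gamma> x (E x u) (\<Gamma> x (E x v) (E x w)) - \<Gamma> x (E x v) (\<Gamma> x (E x u) (E x w))"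
    by (simp add: curvature_def D\<Gamma>_def)
  \<comment> \<open>The second derivatives of the frame cancel by symmetry; the remaining
    first-order terms are the covariant derivative along \<open>br u v\<close>.\<close>
  also have "\<dots> = E x (B u (B v w) - B v (B u w)) - (\<Gamma> x (E x (br u v)) (E x w) + DE x w (E x (br u v)))"
    unfolding d 1 2 3 by (simp add: DDE_sym[OF x, of w "E x u" "E x v"])
  also have "\<dots> = E x (B u (B v w) - B v (B u w) - B (br u v) w)"
    by (simp add: covariant_frame[OF x])
  finally show ?thesis .
qed

lemma cov_deriv_frame:
  assumes I: "open I" "t \<in> I" and x: "x t \<in> U"
    and X: "\<And>s. s \<in> I \<Longrightarrow> X s = E (x s) (y s)"
    and dx: "(x has_vector_derivative E (x t) u) (at t)"
    and dy: "(y has_vector_derivative y') (at t)"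
  shows "cov_deriv G x X t = E (x t) (y' + B u (y t))"
proof -
  \<comment> \<open>Membership in \<open>U\<close> is assumed only at time \<open>t\<close>, but the
    product rule needs linearity of \<open>E (x s)\<close> for all \<open>s\<close> nearby.\<close>
  have "continuous (at t) x"
    using dx by (rule has_vector_derivative_continuous)
  then obtain J where J: "open J" "t \<in> J" "\<And>s. s \<in> J \<Longrightarrow> x s \<in> U"
    using continuous_at_open[of t x] open_U x by meson
  have dE: "((\<lambda>s. E (x s) v) has_derivative (\<lambda>h. DE (x t) v (h *\<^sub>R E (x t) u))) (at t)" for v
    by (rule has_derivative_compose[OF dx[unfolded has_vector_derivative_def] has_derivative_E[OF x]])
  have "((\<lambda>s. E (x s) (y s)) has_derivative
      (\<lambda>h. DE (x t) (y t) (h *\<^sub>R E (x t) u) + E (x t) (h *\<^sub>R y'))) (at t)"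
    using has_derivative_linear_family[where T = "\<lambda>s. E (x s)", OF J(1,2) E_linear[OF J(3)] dE
        dy[unfolded has_vector_derivative_def]] .
  then have "((\<lambda>s. E (x s) (y s)) has_vector_derivative DE (x t) (y t) (E (x t) u) + E (x t) y') (at t)"
    unfolding has_vector_derivative_def
    by (simp add: linear_scale[OF DE_linear[OF x]] linear_scale[OF E_linear[OF x]] scaleR_add_right)
  then have "(X has_vector_derivative DE (x t) (y t) (E (x t) u) + E (x t) y') (at t)"
    by (rule has_vector_derivative_transform_within_open[OF _ I]) (simp add: X)
  then show ?thesis
    using covariant_frame[OF x, of u "y t"] dx
    by (simp add: cov_deriv_def vector_derivative_at X[OF I(2)] linear_add[OF E_linear[OF x]] algebra_simps)
qed

text \<open>With \<open>u\<close> constant, two covariant derivatives are iterates of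
  \<open>y' + B u y\<close>. Steadiness gives \<open>B u u = 0\<close>, and the remainder factors
  through \<open>z = y' + br u y\<close> as \<open>z' - F z\<close>.\<close>

lemma jacobi_frame:
  assumes I: "open I" "t \<in> I" and x: "\<And>s. s \<in> I \<Longrightarrow> x s \<in> U"
    and X: "\<And>s. s \<in> I \<Longrightarrow> X s = E (x s) (y s)"
    and dx: "\<And>s. s \<in> I \<Longrightarrow> (x has_vector_derivative E (x s) u) (at s)"
    and dy: "\<And>s. (y has_vector_derivative y' s) (at s)"
    and dy': "\<And>s. (y' has_vector_derivative y'' s) (at s)"
    and u: "adj u u = 0"
  shows "cov_deriv G x (cov_deriv G x X) t + curvature G (x t) (X t) (E (x t) u) (E (x t) u)
     = E (x t) ((y'' t + br u (y' t)) - (adj u (y' t + br u (y t)) + adj (y' t + br u (y t)) u))"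
proof -
  note [simp] = linear_add[OF B_linear(1)] linear_add[OF B_linear(2)] linear_diff[OF B_linear(1)]
    linear_0[OF B_linear(1)] linear_0[OF B_linear(2)]
    linear_add[OF adj_linear(1)] linear_add[OF adj_linear(2)]
  have xt: "x t \<in> U" using x I by simp
  have 1: "cov_deriv G x X s = E (x s) (y' s + B u (y s))" if "s \<in> I" for s
    by (rule cov_deriv_frame[OF I(1) that x[OF that] X dx[OF that] dy])
  have "((\<lambda>s. B u (y s)) has_vector_derivative B u (y' s)) (at s)" for s
    using bounded_linear.has_vector_derivative[OF _ dy] B_linear(1)[of u]
    by (simp add: linear_conv_bounded_linear)
  then have "((\<lambda>s. y' s + B u (y s)) has_vector_derivative y'' s + B u (y' s)) (at s)" for s
    by (rule has_vector_derivative_add[OF dy'])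
  note dy1 = this[of t]
  have 2: "cov_deriv G x (cov_deriv G x X) t = E (x t) (y'' t + B u (y' t) + B u (y' t + B u (y t)))"
    by (rule cov_deriv_frame[where y = "\<lambda>s. y' s + B u (y s)", OF I xt 1 dx[OF I(2)] dy1])
  have Buu: "B u u = 0"
    by (simp add: B_self u)
  \<comment> \<open>Vanishing torsion turns \<open>B u (B u y) - B u (B y u)\<close> into
    \<open>B u (br u y)\<close>; antisymmetry of the bracket flips the sign of the last curvature
    term.\<close>
  have "y'' t + B u (y' t) + B u (y' t + B u (y t)) + (B (y t) (B u u) - B u (B (y t) u) - B (br (y t) u) u)
     = y'' t + (B u (y' t) + B u (y' t)) + (B u (br u (y t)) + B (br u (y t)) u)"
  proof -
    have "B (br (y t) u) u = - B (br u (y t)) u"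
      using linear_neg[OF B_linear(2), of "br u (y t)" u] br_antisym[of "y t" u] by simp
    moreover have "B u (br u (y t)) = B u (B u (y t)) - B u (B (y t) u)"
      by (simp flip: B_torsion[of u "y t"])
    ultimately show ?thesis by (simp add: Buu)
  qed
  \<comment> \<open>Doubling \<open>B\<close> removes its factor one half; symmetrising it cancels
    the bracket and leaves only adjoint terms.\<close>
  also have "\<dots> = (y'' t + br u (y' t)) - (adj u (y' t + br u (y t)) + adj (y' t + br u (y t)) u)"
  proof -
    have "B v w + B v w = br v w - adj v w - adj w v" for v w
      by (simp add: B_def flip: scaleR_left.add)
    moreover have "B v w + B w v = - adj v w - adj w v" for v w
      unfolding B_def br_antisym[of w v] by (simp add: algebra_simps flip: scaleR_left.add)
    ultimately show ?thesis by simp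
  qed
  finally show ?thesis
    unfolding 2 X[OF I(2)] curvature_frame[OF xt]
    by (simp only: linear_add[OF E_linear[OF xt], symmetric])
qed

section \<open>The Euler-Arnold equation\<close>

lemma E_inv_linear: "x \<in> U \<Longrightarrow> linear (E_inv x)"
proof (rule linearI)
  fix a b and r :: real assume x: "x \<in> U"
  show "E_inv x (a + b) = E_inv x a + E_inv x b"
    using E_eq_iff[OF x, of "E_inv x (a + b)" "E_inv x a + E_inv x b"] x
    by (simp add: linear_add[OF E_linear[OF x]])
  show "E_inv x (r *\<^sub>R a) = r *\<^sub>R E_inv x a"
    using E_eq_iff[OF x, of "E_inv x (r *\<^sub>R a)" "r *\<^sub>R E_inv x a"] x
    by (simp add: linear_scale[OF E_linear[OF x]])
qed

lemma E_inv_smooth: "smooth_on (\<lambda>x. E_inv x z) U"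
proof -
  have "smooth_on (\<lambda>x. G x z (E x b)) U" for b
    by (rule smooth_on_linear_family[where T = "\<lambda>x. G x z", OF open_U metric_linear(2) metric_smooth E_smooth])
  then have *: "smooth_on (\<lambda>x. \<Sum>b\<in>Basis. G x z (E x b) *\<^sub>R b) U"
    by (intro smooth_on_sum[OF open_U finite_Basis] smooth_on_bounded_linear[OF bounded_linear_scaleR_left open_U])
  show ?thesis
    unfolding E_inv_def
    by (rule smooth_on_bounded_linear[OF _ open_U *])
      (use ip.linear_coords_inv in \<open>simp add: linear_conv_bounded_linear\<close>)
qed

text \<open>In the frame the geodesic equation reads \<open>u' + B u u = 0\<close>, and
  \<open>B u u = - adj u u\<close> because the bracket drops out on the diagonal.\<close>

lemma euler_arnold_frame:
  assumes I: "open I" "t \<in> I" and x: "smooth_on x I" "x ` I \<subseteq> U"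
    and u: "\<And>s. s \<in> I \<Longrightarrow> vector_derivative x (at s) = E (x s) (u s)"
    and geod: "cov_deriv G x (\<lambda>s. vector_derivative x (at s)) t = 0"
  shows "(u has_vector_derivative adj (u t) (u t)) (at t)"
proof -
  have xU: "x s \<in> U" if "s \<in> I" for s using x(2) that by auto
  define v where "v s = vector_derivative x (at s)" for s
  have v: "smooth_on v I"
    by (rule smooth_on_cong[OF I(1) smooth_on_frechet_derivative[OF x(1), of 1]])
      (simp add: v_def frechet_derivative_eq_vector_derivative smooth_on_differentiable[OF x(1)])
  \<comment> \<open>\<open>u\<close> is known only pointwise as the frame coefficients of the
    velocity; the smooth inverse frame makes it differentiable.\<close>
  have "smooth_on (\<lambda>s. E_inv (x s) (v s)) I"
  proof (rule smooth_on_linear_family[where T = "\<lambda>s. E_inv (x s)", OF I(1) E_inv_linear[OF xU] _ v])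
    show "smooth_on (\<lambda>s. E_inv (x s) z) I" for z
      by (rule smooth_on_compose[OF open_U I(1) E_inv_smooth x])
  qed
  then have "smooth_on u I"
    by (rule smooth_on_cong[OF I(1)]) (simp add: v_def u xU)
  then have du: "(u has_vector_derivative vector_derivative u (at t)) (at t)"
    using smooth_on_differentiable I(2) vector_derivative_works by blast
  have "(x has_vector_derivative E (x t) (u t)) (at t)"
    using smooth_on_differentiable[OF x(1) I(2)] vector_derivative_works u[OF I(2)] by metis
  then have "E (x t) (vector_derivative u (at t) + B (u t) (u t)) = 0"
    using cov_deriv_frame[OF I xU[OF I(2)] u _ du] geod by simp
  then have "vector_derivative u (at t) + B (u t) (u t) = 0"
    using E_eq_iff[OF xU[OF I(2)], of _ 0] linear_0[OF E_linear[OF xU[OF I(2)]]] by simp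
  then have "vector_derivative u (at t) = adj (u t) (u t)"
    by (simp add: B_self)
  then show ?thesis using du by simp
qed

lemma adj_bounded: "\<exists>K. \<forall>v w. norm (adj v w) \<le> K * norm v * norm w"
proof -
  have "bilinear adj"
    using adj_linear by (simp add: bilinear_def)
  then show ?thesis using bilinear_bounded by blast
qed

lemma euler_arnold_steady_unique:
  assumes u: "\<And>t. (u has_vector_derivative adj (u t) (u t)) (at t)"
    and u0: "u 0 = u0" "adj u0 u0 = 0"
  shows "u t = u0"
proof -
  obtain K where K: "\<And>v w. norm (adj v w) \<le> K * norm v * norm w"
    using adj_bounded by blast
  have "u t - u0 = 0"
  proof (rule gronwall_zero[where w = "\<lambda>t. u t - u0"])
    show "((\<lambda>t. u t - u0) has_vector_derivative adj (u t) (u t)) (at t)" for t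
      using has_vector_derivative_diff[OF u has_vector_derivative_const] by simp
    fix T :: real
    have "continuous_on {-T..T} u"
      using u by (auto intro!: continuous_at_imp_continuous_on has_vector_derivative_continuous)
    then have "bounded (u ` {-T..T})"
      by (intro compact_imp_bounded compact_continuous_image) auto
    then obtain M where M: "\<And>s. s \<in> {-T..T} \<Longrightarrow> norm (u s) \<le> M"
      unfolding bounded_iff by blast
    have "norm (adj (u s) (u s)) \<le> (\<bar>K\<bar> * M + \<bar>K\<bar> * norm u0) * norm (u s - u0)" if "\<bar>s\<bar> \<le> T" for s
    proof -
      \<comment> \<open>Subtracting the vanishing \<open>adj u0 u0\<close> exhibits a factor
        \<open>u s - u0\<close>; the other factor is bounded on \<open>{-T..T}\<close> by
        compactness.\<close>
      have "adj (u s) (u s) = adj (u s) (u s - u0) + adj (u s - u0) u0"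
        using u0(2) by (simp add: linear_diff[OF adj_linear(1)] linear_diff[OF adj_linear(2)])
      also have "norm \<dots> \<le> K * norm (u s) * norm (u s - u0) + K * norm (u s - u0) * norm u0"
        using K by (intro order.trans[OF norm_triangle_ineq] add_mono)
      also have "\<dots> \<le> \<bar>K\<bar> * M * norm (u s - u0) + \<bar>K\<bar> * norm (u s - u0) * norm u0"
        using M[of s] abs_le_D1[OF that] abs_le_D2[OF that] by (intro add_mono mult_right_mono mult_mono) auto
      finally show ?thesis by (simp add: algebra_simps)
    qed
    then show "\<exists>L. \<forall>t. \<bar>t\<bar> \<le> T \<longrightarrow> norm (adj (u t) (u t)) \<le> L * norm (u t - u0)" by blast
  qed (use u0 in simp)
  then show ?thesis by simp
qed

end

section \<open>Lie groups with a left-invariant metric\<close>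

context smooth_manifold
begin

lemma open_chart: "d \<in> atlas \<Longrightarrow> open (fst d)"
  and open_image_of: "d \<in> atlas \<Longrightarrow> open (image_of d)"
  and continuous_on_inv_chart: "d \<in> atlas \<Longrightarrow> continuous_on (image_of d) (inv_chart d)"
  and inv_chart_chart: "d \<in> atlas \<Longrightarrow> p \<in> fst d \<Longrightarrow> inv_chart d (snd d p) = p"
  and chart_inv_chart: "d \<in> atlas \<Longrightarrow> x \<in> image_of d \<Longrightarrow> snd d (inv_chart d x) = x"
  and inv_chart_in: "d \<in> atlas \<Longrightarrow> x \<in> image_of d \<Longrightarrow> inv_chart d x \<in> fst d"
  using charts[of d] by (auto simp: is_chart_def homeomorphism_def)

lemma chart_in: "p \<in> fst d \<Longrightarrow> snd d p \<in> image_of d"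
  by (auto simp: image_of_def)

lemma chart_at: obtains d where "d \<in> atlas" "p \<in> fst d"
  using cover by blast

end

context lie_group
begin

definition translation_domain :: "'p \<Rightarrow> ('p, 'e) chart \<Rightarrow> ('p, 'e) chart \<Rightarrow> 'e set" where
  "translation_domain a c d = {y \<in> image_of c. gmul a (inv_chart c y) \<in> fst d}"

definition mult_domain :: "('p, 'e) chart \<Rightarrow> ('p, 'e) chart \<Rightarrow> ('p, 'e) chart \<Rightarrow> ('e \<times> 'e) set" where
  "mult_domain b c d =
     {(x, y). x \<in> image_of b \<and> y \<in> image_of c \<and> gmul (inv_chart b x) (inv_chart c y) \<in> fst d}"

lemma open_mult_domain:
  assumes "b \<in> atlas" "c \<in> atlas" "d \<in> atlas"
  shows "open (mult_domain b c d)"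
proof -
  let ?f = "\<lambda>z. (inv_chart b (fst z), inv_chart c (snd z))"
  have "continuous_on (image_of b \<times> image_of c) ?f"
    by (intro continuous_intros continuous_on_compose2[OF continuous_on_inv_chart] assms) auto
  then have "continuous_on (image_of b \<times> image_of c) (\<lambda>z. (\<lambda>(p, q). gmul p q) (?f z))"
    by (rule continuous_on_compose2[OF mult_continuous]) auto
  then have "open (image_of b \<times> image_of c \<inter> (\<lambda>z. (\<lambda>(p, q). gmul p q) (?f z)) -` fst d)"
    by (rule continuous_open_preimage) (intro open_Times open_image_of open_chart assms)+
  also have "image_of b \<times> image_of c \<inter> (\<lambda>z. (\<lambda>(p, q). gmul p q) (?f z)) -` fst d = mult_domain b c d"
    by (auto simp: mult_domain_def)
  finally show ?thesis .
qed

lemma smooth_on_mult: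
  assumes "b \<in> atlas" "c \<in> atlas" "d \<in> atlas"
  shows "smooth_on (\<lambda>(x, y). snd d (gmul (inv_chart b x) (inv_chart c y))) (mult_domain b c d)"
  unfolding mult_domain_def by (rule mult_smooth[OF assms])

lemma translation_domain_eq:
  assumes "b \<in> atlas" "a \<in> fst b"
  shows "translation_domain a c d = Pair (snd b a) -` mult_domain b c d"
  using assms chart_in[OF assms(2)] by (auto simp: translation_domain_def mult_domain_def inv_chart_chart)

lemma open_translation_domain:
  assumes "c \<in> atlas" "d \<in> atlas"
  shows "open (translation_domain a c d)"
proof -
  obtain b where b: "b \<in> atlas" "a \<in> fst b" by (rule chart_at)
  show ?thesis
    unfolding translation_domain_eq[OF b]
    by (intro open_vimage open_mult_domain b assms continuous_intros)
qed

text \<open>Smoothness is assumed for multiplication in two chart variables. Freezing the first at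
  the coordinates of \<open>a\<close> in some chart gives the translation.\<close>

lemma smooth_on_translation:
  assumes "c \<in> atlas" "d \<in> atlas"
  shows "smooth_on (snd d \<circ> gmul a \<circ> inv_chart c) (translation_domain a c d)"
proof -
  obtain b where b: "b \<in> atlas" "a \<in> fst b" by (rule chart_at)
  have "smooth_on (\<lambda>y. (\<lambda>(x, y). snd d (gmul (inv_chart b x) (inv_chart c y))) (snd b a, y))
      (translation_domain a c d)"
    using translation_domain_eq[OF b]
    by (intro smooth_on_compose[OF open_mult_domain open_translation_domain smooth_on_mult]
        smooth_on_Pair smooth_on_const smooth_on_ident open_translation_domain b assms) auto
  then show ?thesis by (simp add: inv_chart_chart b o_def)
qed

lemma translation_in_domain:
  "c \<in> atlas \<Longrightarrow> p \<in> fst c \<Longrightarrow> gmul a p \<in> fst d \<Longrightarrow> snd c p \<in> translation_domain a c d"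
  by (simp add: translation_domain_def chart_in inv_chart_chart)

lemma has_derivative_translation:
  assumes "c \<in> atlas" "d \<in> atlas" "p \<in> fst c" "gmul a p \<in> fst d"
  shows "(snd d \<circ> gmul a \<circ> inv_chart c has_derivative tangent_map (gmul a) c d p) (at (snd c p))"
  unfolding tangent_map_def
  by (rule smooth_on_has_derivative[OF smooth_on_translation translation_in_domain]) (use assms in auto)

lemma tangent_map_translation_compose:
  assumes "c \<in> atlas" "d \<in> atlas" "d' \<in> atlas" "p \<in> fst c" "gmul b p \<in> fst d" "gmul a (gmul b p) \<in> fst d'"
  shows "tangent_map (gmul a) d d' (gmul b p) (tangent_map (gmul b) c d p v)
    = tangent_map (gmul (gmul a b)) c d' p v"
proof -
  let ?f = "snd d \<circ> gmul b \<circ> inv_chart c" and ?g = "snd d' \<circ> gmul a \<circ> inv_chart d"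
  have fx: "?f (snd c p) = snd d (gmul b p)" using assms by (simp add: inv_chart_chart)
  have g: "(?g has_derivative tangent_map (gmul a) d d' (gmul b p)) (at (?f (snd c p)))"
    unfolding fx using assms by (intro has_derivative_translation)
  have "((\<lambda>y. ?g (?f y)) has_derivative
      (\<lambda>v. tangent_map (gmul a) d d' (gmul b p) (tangent_map (gmul b) c d p v))) (at (snd c p))"
    by (rule has_derivative_compose[where f = ?f and g = ?g, OF _ g]) (use assms in \<open>intro has_derivative_translation\<close>)
  then have "(snd d' \<circ> gmul (gmul a b) \<circ> inv_chart c has_derivative
      (\<lambda>v. tangent_map (gmul a) d d' (gmul b p) (tangent_map (gmul b) c d p v))) (at (snd c p))"
    by (rule has_derivative_transform_within_open[OF _ open_translation_domain[OF assms(1,2)]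
          translation_in_domain[OF assms(1,4,5)]])
      (use assms in \<open>simp add: translation_domain_def inv_chart_chart assoc\<close>)
  then show ?thesis
    unfolding tangent_map_def[of "gmul (gmul a b)"] by (simp add: frechet_derivative_eq)
qed

lemma gmul_ident: "gmul ident = id"
  by (auto simp: group_left_neutral)

end

locale invariant_metric = lie_group atlas gmul ident ginv
  for atlas :: "('p::{t2_space, second_countable_topology}, 'e::euclidean_space) chart set"
    and gmul :: "'p \<Rightarrow> 'p \<Rightarrow> 'p" and ident :: 'p and ginv :: "'p \<Rightarrow> 'p" +
  fixes g :: "('p, 'e) metric_field" and c :: "('p, 'e) chart"
  assumes left_invariant: "left_invariant_metric atlas gmul g"
    and c: "c \<in> atlas" "ident \<in> fst c"
begin

text \<open>Values at the identity are always read in the fixed chart \<open>c\<close>, values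
  elsewhere in \<open>d\<close>. For \<open>d = c\<close> this is \<open>left_field\<close>;
  arbitrary \<open>d\<close> is needed because a geodesic may leave the domain of
  \<open>c\<close>.\<close>

definition E :: "('p, 'e) chart \<Rightarrow> 'e \<Rightarrow> 'e \<Rightarrow> 'e" where
  "E d x = tangent_map (gmul (inv_chart d x)) c d ident"

definition ip :: "'e \<Rightarrow> 'e \<Rightarrow> real" where
  "ip = g c (snd c ident)"

abbreviation br :: "'e \<Rightarrow> 'e \<Rightarrow> 'e" where
  "br \<equiv> lie_ad gmul ident c"

lemma right_ident [simp]: "gmul a ident = a"
  using right_neutral .

lemma E_chart: "d \<in> atlas \<Longrightarrow> p \<in> fst d \<Longrightarrow> E d (snd d p) = tangent_map (gmul p) c d ident"
  by (simp add: E_def inv_chart_chart)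

lemma translate_E:
  assumes "d \<in> atlas" "d' \<in> atlas" "q \<in> fst d" "gmul a q \<in> fst d'"
  shows "tangent_map (gmul a) d d' q (E d (snd d q) v) = E d' (snd d' (gmul a q)) v"
  using tangent_map_translation_compose[OF c(1) assms(1,2) c(2), of q a] assms by (simp add: E_chart)

text \<open>A change of charts is translation by \<open>ident\<close>. The resulting rule is the
  transformation law demanded by \<open>field_along\<close>.\<close>

lemma change_of_chart_E:
  assumes "d \<in> atlas" "d' \<in> atlas" "q \<in> fst d" "q \<in> fst d'"
  shows "tangent_map id d d' q (E d (snd d q) v) = E d' (snd d' q) v"
  using translate_E[OF assms(1-3), of ident v] assms(4) by (simp add: gmul_ident)

lemma E_ident: "E c (snd c ident) = (\<lambda>v. v)"
proof -
  have "(snd c \<circ> id \<circ> inv_chart c has_derivative (\<lambda>v. v)) (at (snd c ident))"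
    by (rule has_derivative_transform_within_open[OF has_derivative_ident open_image_of[OF c(1)] chart_in[OF c(2)]])
      (simp add: chart_inv_chart c)
  then show ?thesis
    by (simp add: E_chart[OF c] gmul_ident tangent_map_def frechet_derivative_eq)
qed

lemma has_derivative_E_translation:
  assumes "d \<in> atlas" "x \<in> image_of d"
  shows "(snd d \<circ> gmul (inv_chart d x) \<circ> inv_chart c has_derivative E d x) (at (snd c ident))"
  unfolding E_def using assms inv_chart_in[OF assms] c by (intro has_derivative_translation) auto

lemma linear_E: "d \<in> atlas \<Longrightarrow> x \<in> image_of d \<Longrightarrow> linear (E d x)"
  using has_derivative_E_translation has_derivative_linear by blast

text \<open>The frame is the partial derivative of multiplication in its second argument at the
  identity, and multiplication is jointly smooth.\<close>

lemma smooth_on_E: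
  assumes d: "d \<in> atlas"
  shows "smooth_on (\<lambda>x. E d x v) (image_of d)"
proof -
  let ?M = "\<lambda>(x, y). snd d (gmul (inv_chart d x) (inv_chart c y))"
  let ?e = "snd c ident"
  have dom: "(x, ?e) \<in> mult_domain d c d" if "x \<in> image_of d" for x
    using that d c chart_in[OF c(2)] inv_chart_in[OF d that] by (auto simp: mult_domain_def inv_chart_chart)
  have "smooth_on (\<lambda>x. frechet_derivative ?M (at (x, ?e)) (0, v)) (image_of d)"
    by (rule smooth_on_compose[where f = "\<lambda>z. frechet_derivative ?M (at z) (0, v)" and g = "\<lambda>x. (x, ?e)",
          OF open_mult_domain[OF d c(1) d] open_image_of[OF d] smooth_on_frechet_derivative[OF smooth_on_mult[OF d c(1) d]]])
      (use dom open_image_of[OF d] in \<open>auto intro!: smooth_on_Pair smooth_on_const smooth_on_ident\<close>)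
  then show ?thesis
  proof (rule smooth_on_cong[OF open_image_of[OF d]])
    fix x assume x: "x \<in> image_of d"
    have "(?M has_derivative frechet_derivative ?M (at (x, ?e))) (at (x, ?e))"
      by (rule smooth_on_has_derivative[OF smooth_on_mult[OF d c(1) d] dom[OF x]])
    then have "((\<lambda>y. ?M (x, y)) has_derivative (\<lambda>v. frechet_derivative ?M (at (x, ?e)) (0, v))) (at ?e)"
      by (rule has_derivative_compose[rotated]) (auto intro!: derivative_eq_intros)
    then have "(snd d \<circ> gmul (inv_chart d x) \<circ> inv_chart c has_derivative
        (\<lambda>v. frechet_derivative ?M (at (x, ?e)) (0, v))) (at ?e)"
      by (simp add: o_def)
    from fun_cong[OF has_derivative_unique[OF this has_derivative_E_translation[OF d x]]]
    show "frechet_derivative ?M (at (x, ?e)) (0, v) = E d x v" .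
  qed
qed

lemma inner_form_metric: "d \<in> atlas \<Longrightarrow> x \<in> image_of d \<Longrightarrow> inner_form (g d x)"
  using left_invariant unfolding left_invariant_metric_def riemannian_metric_def
  by unfold_locales (blast+)

lemma lie_ad_eq: "br v w = field_bracket (\<lambda>x. E c x v) (\<lambda>x. E c x w) (snd c ident)"
  unfolding lie_ad_def left_field_def E_def ..

text \<open>\<open>br\<close> is defined at the identity in \<open>c\<close> only. Left translation
  \<phi> carries the frame to itself, so the fields in \<open>c\<close> and in \<open>d\<close> are
  \<phi>-related, and brackets respect this relation.\<close>

lemma E_bracket:
  assumes d: "d \<in> atlas" and x: "x \<in> image_of d"
  shows "field_bracket (\<lambda>x. E d x v) (\<lambda>x. E d x w) x = E d x (br v w)"
proof -
  define p where "p = inv_chart d x"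
  define e where "e = snd c ident"
  define \<phi> where "\<phi> = snd d \<circ> gmul p \<circ> inv_chart c"
  define D where "D = translation_domain p c d"
  have p: "p \<in> fst d" "snd d p = x" using inv_chart_in[OF d x] chart_inv_chart[OF d x] by (auto simp: p_def)
  have D: "open D" "e \<in> D"
    using open_translation_domain[OF c(1) d] translation_in_domain[OF c] p by (auto simp: D_def e_def)
  have \<phi>: "smooth_on \<phi> D" unfolding \<phi>_def D_def by (rule smooth_on_translation[OF c(1) d])
  have \<phi>e: "\<phi> e = x" by (simp add: \<phi>_def e_def inv_chart_chart c p)
  have d\<phi>: "frechet_derivative \<phi> (at e) = E d x"
    unfolding \<phi>_def e_def p_def by (rule frechet_derivative_eq[OF has_derivative_E_translation[OF d x]])
  have push: "frechet_derivative \<phi> (at y) (E c y u) = E d (\<phi> y) u" if "y \<in> D" for y u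
    using that translate_E[OF c(1) d, of "inv_chart c y" p u]
    by (simp add: D_def translation_domain_def tangent_map_def \<phi>_def inv_chart_in[OF c(1)] chart_inv_chart[OF c(1)])
  have eU: "e \<in> image_of c" by (simp add: e_def chart_in c)
  define E2 where "E2 u h = frechet_derivative (\<lambda>y. E c y u) (at e) h" for u h
  define D2 where "D2 a h = frechet_derivative (\<lambda>y. frechet_derivative \<phi> (at y) a) (at e) h" for a h
  have D2: "((\<lambda>y. frechet_derivative \<phi> (at y) a) has_derivative D2 a) (at e)" for a
    unfolding D2_def by (rule smooth_on_has_derivative[OF smooth_on_frechet_derivative[OF \<phi>] D(2)])
  have E2: "((\<lambda>y. E c y u) has_derivative E2 u) (at e)" for u
    unfolding E2_def by (rule smooth_on_has_derivative[OF smooth_on_E[OF c(1)] eU])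
  \<comment> \<open>Both sides of \<open>push\<close> are differentiated at the identity: one by the
    product rule, the other by the chain rule, using that \<open>E c\<close> is the identity map
    there.\<close>
  have key: "frechet_derivative (\<lambda>x. E d x u) (at x) (E d x u') = D2 u u' + E d x (E2 u u')" for u u'
  proof -
    have l: "linear (frechet_derivative \<phi> (at y))" if "y \<in> D" for y
      using smooth_on_has_derivative[OF \<phi> that] has_derivative_linear by blast
    have "((\<lambda>y. frechet_derivative \<phi> (at y) (E c y u)) has_derivative
        (\<lambda>h. D2 (E c e u) h + frechet_derivative \<phi> (at e) (E2 u h))) (at e)"
      by (rule has_derivative_linear_family[where T = "\<lambda>y. frechet_derivative \<phi> (at y)", OF D l D2 E2])
    then have 1: "((\<lambda>y. E d (\<phi> y) u) has_derivative
        (\<lambda>h. D2 (E c e u) h + frechet_derivative \<phi> (at e) (E2 u h))) (at e)"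
      by (rule has_derivative_transform_within_open[OF _ D push])
    have "((\<lambda>x. E d x u) has_derivative frechet_derivative (\<lambda>x. E d x u) (at (\<phi> e))) (at (\<phi> e))"
      unfolding \<phi>e by (rule smooth_on_has_derivative[OF smooth_on_E[OF d] x])
    from has_derivative_compose[OF smooth_on_has_derivative[OF \<phi> D(2)] this]
    have "((\<lambda>y. E d (\<phi> y) u) has_derivative
        (\<lambda>h. frechet_derivative (\<lambda>x. E d x u) (at x) (frechet_derivative \<phi> (at e) h))) (at e)"
      by (simp add: \<phi>e)
    from fun_cong[OF has_derivative_unique[OF this 1], of u'] show ?thesis
      by (simp add: d\<phi> E_ident[folded e_def])
  qed
  \<comment> \<open>The second derivative of the translation is symmetric, so it disappears from the
    bracket.\<close>
  have "D2 v w = D2 w v"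
    unfolding D2_def by (rule symmetric_second_derivative[OF D \<phi>])
  then show ?thesis
    unfolding field_bracket_def key lie_ad_eq
    by (simp add: linear_diff[OF linear_E[OF d x]] E_ident[folded e_def] E2_def flip: e_def)
qed

text \<open>At the identity the frame is the identity map, so the bracket is the antisymmetrised
  derivative of the frame, which is linear in the direction and in the frame vector.\<close>

lemma bilinear_lie_ad: "bilinear br"
proof -
  have e: "snd c ident \<in> image_of c" by (simp add: chart_in c)
  define E2 where "E2 u h = frechet_derivative (\<lambda>y. E c y u) (at (snd c ident)) h" for u h
  have E2: "((\<lambda>y. E c y u) has_derivative E2 u) (at (snd c ident))" for u
    unfolding E2_def by (rule smooth_on_has_derivative[OF smooth_on_E[OF c(1)] e])
  have 1: "linear (E2 u)" for u using E2 has_derivative_linear by blast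
  have 2: "linear (\<lambda>u. E2 u h)" for h
    by (rule linear_derivative_family[OF open_image_of[OF c(1)] e linear_E[OF c(1)] E2])
  have br: "br v w = E2 w v - E2 v w" for v w
    unfolding lie_ad_eq field_bracket_def E2_def by (simp add: E_ident)
  show ?thesis
    unfolding bilinear_def br by (intro conjI allI linear_compose_sub 1 2)
qed

lemma frame:
  assumes d: "d \<in> atlas" "fst d \<noteq> {}"
  shows "frame (image_of d) (g d) (E d) ip br"
proof (rule frame.intro)
  show "open (image_of d)" by (rule open_image_of[OF d(1)])
  show "inner_form (g d x)" if "x \<in> image_of d" for x by (rule inner_form_metric[OF d(1) that])
  show "smooth_on (\<lambda>x. g d x v w) (image_of d)" for v w
    using left_invariant d(1) unfolding left_invariant_metric_def riemannian_metric_def by blast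
  show "inner_form ip" unfolding ip_def by (rule inner_form_metric[OF c(1) chart_in[OF c(2)]])
  show "linear (E d x)" if "x \<in> image_of d" for x by (rule linear_E[OF d(1) that])
  show "smooth_on (\<lambda>x. E d x v) (image_of d)" for v by (rule smooth_on_E[OF d(1)])
  show "g d x (E d x v) (E d x w) = ip v w" if "x \<in> image_of d" for x v w
  proof -
    have "ident \<in> fst c \<and> gmul (inv_chart d x) ident \<in> fst d"
      using c(2) inv_chart_in[OF d(1) that] by simp
    then have "\<forall>v w. g d (snd d (gmul (inv_chart d x) ident)) (tangent_map (gmul (inv_chart d x)) c d ident v)
        (tangent_map (gmul (inv_chart d x)) c d ident w) = g c (snd c ident) v w"
      using left_invariant c(1) d(1) unfolding left_invariant_metric_def by blast
    then show ?thesis by (simp add: E_def ip_def chart_inv_chart[OF d(1) that])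
  qed
  show "bilinear br" by (rule bilinear_lie_ad)
  show "field_bracket (\<lambda>x. E d x v) (\<lambda>x. E d x w) x = E d x (br v w)" if "x \<in> image_of d" for x v w
    by (rule E_bracket[OF d(1) that])
  show "image_of d \<noteq> {}" using d(2) by (simp add: image_of_def)
qed

section \<open>Geodesics and Jacobi fields on the group\<close>

definition adj :: "'e \<Rightarrow> 'e \<Rightarrow> 'e" where
  "adj = lie_ad_star gmul ident c g"

lemma frame_c: "frame (image_of c) (g c) (E c) ip br"
  by (rule frame) (use c in auto)

lemma frame_adj: "frame.adj ip br = adj"
  using frame.adj_def[OF frame_c] by (simp add: fun_eq_iff adj_def lie_ad_star_def ip_def)

lemma adj_linear: "linear (adj u)" "linear (\<lambda>u. adj u v)"
  using frame.adj_linear[OF frame_c] unfolding frame_adj by auto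

text \<open>The coefficient curve \<open>u\<close> of the velocity must be global in time although
  each chart sees only part of \<open>\<gamma>\<close>. Once its independence of the chart is known,
  the local Euler-Arnold equations form one equation on the whole line, and uniqueness makes
  \<open>u\<close> constant.\<close>

lemma geodesic_steady_velocity:
  assumes \<gamma>: "geodesic atlas g \<gamma>" "\<gamma> 0 = ident" "velocity \<gamma> c 0 = u0"
    and u0: "adj u0 u0 = 0"
    and d: "d \<in> atlas" "\<gamma> t \<in> fst d"
  shows "(snd d \<circ> \<gamma> has_vector_derivative E d (snd d (\<gamma> t)) u0) (at t)"
proof -
  define I where "I d = \<gamma> -` fst d" for d :: "('p, 'e) chart"
  have cont: "continuous_on UNIV \<gamma>" and smooth: "\<And>d. d \<in> atlas \<Longrightarrow> smooth_on (snd d \<circ> \<gamma>) (I d)"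
    using \<gamma>(1) by (auto simp: geodesic_def smooth_curve_def I_def)
  have I: "open (I d)" if "d \<in> atlas" for d
    unfolding I_def using cont open_chart[OF that] by (simp add: open_vimage)
  have vel: "(snd d \<circ> \<gamma> has_vector_derivative velocity \<gamma> d s) (at s)" if "d \<in> atlas" "s \<in> I d" for d s
    unfolding velocity_def using smooth_on_differentiable[OF smooth that(2)] that(1)
    by (simp add: vector_derivative_works)
  \<comment> \<open>An arbitrary chart for each time. It may jump with \<open>s\<close>, so
    \<open>u\<close> has no regularity at first.\<close>
  define ch where "ch s = (SOME d. d \<in> atlas \<and> \<gamma> s \<in> fst d)" for s
  have ch: "ch s \<in> atlas" "\<gamma> s \<in> fst (ch s)" for s
  proof -
    obtain d where "d \<in> atlas \<and> \<gamma> s \<in> fst d" using chart_at[of "\<gamma> s"] by blast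
    then have "ch s \<in> atlas \<and> \<gamma> s \<in> fst (ch s)" unfolding ch_def by (rule someI)
    then show "ch s \<in> atlas" "\<gamma> s \<in> fst (ch s)" by auto
  qed
  have "\<exists>u. velocity \<gamma> (ch s) s = E (ch s) (snd (ch s) (\<gamma> s)) u" for s
    using frame.E_cases[OF frame[OF ch(1)]] ch(2)[of s] chart_in[OF ch(2)[of s]] by blast
  then obtain u where u: "\<And>s. velocity \<gamma> (ch s) s = E (ch s) (snd (ch s) (\<gamma> s)) (u s)"
    by metis
  \<comment> \<open>Velocity and frame change by the same differential between charts, so the
    coefficients do not depend on the choice \<open>ch\<close>.\<close>
  have velE: "velocity \<gamma> d s = E d (snd d (\<gamma> s)) (u s)" if d: "d \<in> atlas" "s \<in> I d" for d s
  proof -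
    let ?b = "ch s"
    have s: "\<gamma> s \<in> fst d" using d by (simp add: I_def)
    have 1: "(snd d \<circ> id \<circ> inv_chart ?b has_derivative tangent_map id ?b d (\<gamma> s)) (at ((snd ?b \<circ> \<gamma>) s))"
      using has_derivative_translation[OF ch(1) d(1) ch(2), of ident s] s by (simp add: gmul_ident)
    have "((\<lambda>r. (snd d \<circ> id \<circ> inv_chart ?b) ((snd ?b \<circ> \<gamma>) r)) has_derivative
        (\<lambda>h. tangent_map id ?b d (\<gamma> s) (h *\<^sub>R velocity \<gamma> ?b s))) (at s)"
      using vel[OF ch(1), of s s] ch(2)[of s] unfolding has_vector_derivative_def I_def
      by (intro has_derivative_compose[where f = "snd ?b \<circ> \<gamma>" and g = "snd d \<circ> id \<circ> inv_chart ?b", OF _ 1]) auto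
    then have "(snd d \<circ> \<gamma> has_derivative (\<lambda>h. tangent_map id ?b d (\<gamma> s) (h *\<^sub>R velocity \<gamma> ?b s))) (at s)"
      by (rule has_derivative_transform_within_open[OF _ I[OF ch(1), of s]])
        (use ch in \<open>auto simp: I_def inv_chart_chart\<close>)
    then have "(snd d \<circ> \<gamma> has_vector_derivative tangent_map id ?b d (\<gamma> s) (velocity \<gamma> ?b s)) (at s)"
      using linear_scale[OF has_derivative_linear[OF 1]] by (simp add: has_vector_derivative_def)
    then have "velocity \<gamma> d s = tangent_map id ?b d (\<gamma> s) (velocity \<gamma> ?b s)"
      using vel[OF d] vector_derivative_unique_at by blast
    then show ?thesis
      unfolding u using change_of_chart_E[OF ch(1) d(1) ch(2) s] by simp
  qed
  have "(u has_vector_derivative adj (u s) (u s)) (at s)" for s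
  proof -
    let ?b = "ch s"
    have sI: "s \<in> I ?b" using ch by (simp add: I_def)
    have fr: "frame (image_of ?b) (g ?b) (E ?b) ip br" using frame ch by blast
    have "(u has_vector_derivative frame.adj ip br (u s) (u s)) (at s)"
    proof (rule frame.euler_arnold_frame[OF fr I[OF ch(1)] sI smooth[OF ch(1)]])
      show "(snd ?b \<circ> \<gamma>) ` I ?b \<subseteq> image_of ?b" by (auto simp: I_def chart_in)
      show "vector_derivative (snd ?b \<circ> \<gamma>) (at r) = E ?b ((snd ?b \<circ> \<gamma>) r) (u r)" if "r \<in> I ?b" for r
        using velE[OF ch(1) that] by (simp add: velocity_def)
      have "(\<lambda>s. vector_derivative (snd ?b \<circ> \<gamma>) (at s)) = velocity \<gamma> ?b"
        by (simp add: fun_eq_iff velocity_def)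
      then show "cov_deriv (g ?b) (snd ?b \<circ> \<gamma>) (\<lambda>s. vector_derivative (snd ?b \<circ> \<gamma>) (at s)) s = 0"
        using \<gamma>(1) ch by (simp add: geodesic_def)
    qed
    then show ?thesis by (simp only: frame_adj)
  qed
  moreover have "u 0 = u0"
    using velE[OF c(1), of 0] c(2) \<gamma>(2,3) E_ident by (simp add: I_def)
  ultimately have "u t = u0"
    using frame.euler_arnold_steady_unique[OF frame_c, of u u0 t] u0 by (simp add: frame_adj)
  then show ?thesis using vel[OF d(1), of t] velE[OF d(1), of t] d(2) by (simp add: I_def)
qed

text \<open>In each chart the velocity has the constant coefficient \<open>u0\<close>, so
  \<open>jacobi_frame\<close> applies there; compatibility between charts is that of the frame
  itself.\<close>

lemma jacobi_field_translated:
  assumes \<gamma>: "geodesic atlas g \<gamma>" "\<gamma> 0 = ident" "velocity \<gamma> c 0 = u0"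
    and u0: "adj u0 u0 = 0"
    and y: "smooth_on y UNIV"
      "\<And>t. (y has_vector_derivative y' t) (at t)" "\<And>t. (y' has_vector_derivative y'' t) (at t)"
    and eq: "\<And>t. y'' t + br u0 (y' t) = adj u0 (y' t + br u0 (y t)) + adj (y' t + br u0 (y t)) u0"
  shows "jacobi_field atlas g \<gamma> (\<lambda>d t. E d (snd d (\<gamma> t)) (y t))"
  unfolding jacobi_field_def field_along_def
proof (intro conjI ballI allI impI)
  have cont: "continuous_on UNIV \<gamma>"
    and smooth: "\<And>d. d \<in> atlas \<Longrightarrow> smooth_on (snd d \<circ> \<gamma>) (\<gamma> -` fst d)"
    using \<gamma>(1) by (auto simp: geodesic_def smooth_curve_def)
  fix d assume d: "d \<in> atlas"
  have I: "open (\<gamma> -` fst d)"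
    using cont open_chart[OF d] by (simp add: open_vimage)
  have x: "(snd d \<circ> \<gamma>) ` (\<gamma> -` fst d) \<subseteq> image_of d" by (auto simp: chart_in)
  show "smooth_on (\<lambda>t. E d (snd d (\<gamma> t)) (y t)) (\<gamma> -` fst d)"
  proof (rule smooth_on_linear_family[where T = "\<lambda>t. E d (snd d (\<gamma> t))", OF I])
    show "linear (E d (snd d (\<gamma> t)))" if "t \<in> \<gamma> -` fst d" for t
      using that linear_E[OF d chart_in] by simp
    show "smooth_on (\<lambda>t. E d (snd d (\<gamma> t)) v) (\<gamma> -` fst d)" for v
      using smooth_on_compose[OF open_image_of[OF d] I smooth_on_E[OF d] smooth[OF d] x] by simp
    show "smooth_on y (\<gamma> -` fst d)" by (rule smooth_on_subset[OF y(1)]) simp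
  qed
  show "E d' (snd d' (\<gamma> t)) (y t) = tangent_map id d d' (\<gamma> t) (E d (snd d (\<gamma> t)) (y t))"
    if "d' \<in> atlas" "\<gamma> t \<in> fst d \<inter> fst d'" for d' t
    using change_of_chart_E[OF d that(1)] that(2) by simp
  fix t assume t: "\<gamma> t \<in> fst d"
  have fr: "frame (image_of d) (g d) (E d) ip br" using frame[OF d] t by blast
  let ?J = "\<lambda>t. E d (snd d (\<gamma> t)) (y t)"
  have v: "(snd d \<circ> \<gamma> has_vector_derivative E d ((snd d \<circ> \<gamma>) s) u0) (at s)" if "s \<in> \<gamma> -` fst d" for s
    using geodesic_steady_velocity[OF \<gamma> u0 d] that by simp
  have "cov_deriv (g d) (snd d \<circ> \<gamma>) (cov_deriv (g d) (snd d \<circ> \<gamma>) ?J) t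
      + curvature (g d) ((snd d \<circ> \<gamma>) t) (?J t) (E d ((snd d \<circ> \<gamma>) t) u0) (E d ((snd d \<circ> \<gamma>) t) u0)
     = E d ((snd d \<circ> \<gamma>) t) ((y'' t + br u0 (y' t))
         - (frame.adj ip br u0 (y' t + br u0 (y t)) + frame.adj ip br (y' t + br u0 (y t)) u0))"
    by (rule frame.jacobi_frame[OF fr I _ _ _ v y(2,3)]) (use t u0 frame_adj in \<open>auto simp: chart_in\<close>)
  also have "\<dots> = 0"
    using eq[of t] t by (simp add: frame_adj linear_0[OF linear_E[OF d chart_in]])
  finally show "cov_deriv (g d) (snd d \<circ> \<gamma>) (cov_deriv (g d) (snd d \<circ> \<gamma>) ?J) t
      + curvature (g d) (snd d (\<gamma> t)) (?J t) (velocity \<gamma> d t) (velocity \<gamma> d t) = 0"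
    using vector_derivative_at[OF v[of t]] t by (simp add: velocity_def)
qed

text \<open>The frame is injective at every point, so the field vanishes exactly where
  \<open>y\<close> does.\<close>

lemma conjugate_point_translated:
  assumes "jacobi_field atlas g \<gamma> (\<lambda>d t. E d (snd d (\<gamma> t)) (y t))"
    and "y 0 = 0" "y \<tau> = 0" "\<tau> > 0" "y s \<noteq> 0"
  shows "has_conjugate_point atlas g \<gamma>"
proof -
  let ?J = "\<lambda>d t. E d (snd d (\<gamma> t)) (y t)"
  have van: "vanishes_at atlas \<gamma> ?J t" if "y t = 0" for t
    using that by (simp add: vanishes_at_def linear_0[OF linear_E[OF _ chart_in]])
  obtain d where d: "d \<in> atlas" "\<gamma> s \<in> fst d" by (rule chart_at)
  have fr: "frame (image_of d) (g d) (E d) ip br" using frame d by blast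
  have "?J d s \<noteq> 0"
    using frame.E_eq_iff[OF fr chart_in[OF d(2)], of "y s" 0] \<open>y s \<noteq> 0\<close>
      linear_0[OF linear_E[OF d(1) chart_in[OF d(2)]]] by simp
  then have "\<not> vanishes_at atlas \<gamma> ?J s" using d by (auto simp: vanishes_at_def)
  then show ?thesis
    unfolding has_conjugate_point_def using assms(1,4) van[OF assms(2)] van[OF assms(3)] by blast
qed

end

theorem proposition4p9:
  fixes atlas :: "('p::{t2_space, second_countable_topology}, 'e::euclidean_space) chart set"
    and gmul :: "'p \<Rightarrow> 'p \<Rightarrow> 'p" and ident :: 'p and ginv :: "'p \<Rightarrow> 'p"
    and g :: "('p, 'e) metric_field"
    and c :: "('p, 'e) chart"
    and ad ad_star :: "'e \<Rightarrow> 'e \<Rightarrow> 'e"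
    and u\<^sub>0 :: 'e and A F S :: "'e \<Rightarrow> 'e" and \<Omega> :: "'e set"
    and \<gamma> :: "real \<Rightarrow> 'p" and \<tau> :: real
  assumes "lie_group atlas gmul ident ginv"
    and "left_invariant_metric atlas gmul g"
    and "c \<in> atlas" and "ident \<in> fst c"
    and "ad = lie_ad gmul ident c"
    and "ad_star = lie_ad_star gmul ident c g"
    and "ad_star u\<^sub>0 u\<^sub>0 = 0"
    and "\<And>v. A v = ad u\<^sub>0 v"
    and "\<And>v. F v = ad_star u\<^sub>0 v + ad_star v u\<^sub>0"
    and "subspace \<Omega>" and "A ` \<Omega> \<subseteq> \<Omega>" and "F ` \<Omega> \<subseteq> \<Omega>"
    and "operator_on \<Omega> S"
    and "\<And>v. v \<in> \<Omega> \<Longrightarrow> S (F v) + A (S v) = v"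
    and "geodesic atlas g \<gamma>" and "\<gamma> 0 = ident" and "velocity \<gamma> c 0 = u\<^sub>0"
    and "\<tau> > 0"
    and "det_on \<Omega> (\<lambda>v. op_exp (\<lambda>w. \<tau> *\<^sub>R A w) (S (op_exp (\<lambda>w. \<tau> *\<^sub>R F w) v)) - S v) = 0"
  shows "has_conjugate_point atlas g \<gamma>"
proof -
  interpret invariant_metric atlas gmul ident ginv g c
    using assms(1-4) by (simp add: invariant_metric_def invariant_metric_axioms_def)
  have ad: "ad = br" and ad_star: "ad_star = adj"
    using assms(5,6) by (simp_all add: adj_def)
  have A: "linear A"
    using bilinear_lie_ad assms(8) unfolding ad bilinear_def by (metis (no_types) ext)
  have F: "linear F"
  proof -
    have "F = (\<lambda>v. adj u\<^sub>0 v + adj v u\<^sub>0)" using assms(9) ad_star by auto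
    then show ?thesis using adj_linear by (simp add: linear_compose_add)
  qed
  obtain y y' y'' where y: "smooth_on y UNIV"
    "\<And>t. (y has_vector_derivative y' t) (at t)" "\<And>t. (y' has_vector_derivative y'' t) (at t)"
    and eq: "\<And>t. y'' t + A (y' t) = F (y' t + A (y t))"
    and y0: "y 0 = 0" "y \<tau> = 0" "\<exists>t. y t \<noteq> 0"
    by (rule sylvester_solution[OF A F assms(10-14) assms(19)]) (assumption, rule that)
  \<comment> \<open>With \<open>A\<close> and \<open>F\<close> unfolded, \<open>eq\<close> is the
    left-translated Jacobi equation.\<close>
  have "jacobi_field atlas g \<gamma> (\<lambda>d t. E d (snd d (\<gamma> t)) (y t))"
    using eq assms(7,8,9)
    by (intro jacobi_field_translated[OF assms(15-17) _ y]) (simp_all add: ad ad_star)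
  then show ?thesis
    using conjugate_point_translated y0 \<open>\<tau> > 0\<close> by blast
qed

end
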